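(* Let $U\subseteq\widetilde{\mathbb{R}}^n$ be a non-empty sharply open set and let $\emptyset\ne K\subseteq U$ be functionally compact. Then the space $\mathcal{GD}_K(U)$ with the sharp topology is complete.
   Context: Generalized numbers: $I=(0,1]$; nets are indexed by $\varepsilon\in I$; "for $\varepsilon$ small" means for all $\varepsilon\in(0,\varepsilon_0]$ for some $\varepsilon_0\in I$. A net $(x_\varepsilon)$ in $\mathbb{R}^n$ is moderate if $|x_\varepsilon|=O(\varepsilon^{-N})$ as $\varepsilon\to0$ for some $N\in\mathbb{N}$; $(x_\varepsilon)\sim(y_\varepsilon)$ iff $|x_\varepsilon-y_\varepsilon|=O(\varepsilon^m)$ for all $m\in\mathbb{N}$. $\widetilde{\mathbb{R}}^n$ is the set of classes $[x_\varepsilon]$ of moderate nets in $\mathbb{R}^n$; $\widetilde{\mathbb{R}}$ is a ring. $x\le y$ iff there are representatives with $x_\varepsilon\le y_\varepsilon$ for $\varepsilon$ small; $x<y$ means $x\le y$ and $y-x$ invertible. $|[x_\varepsilon]|:=[|x_\varepsilon|]$. The sharp topology on $\widetilde{\mathbb{R}}^n$ is generated by the balls $\{y : |y-x|<\rho\}$, $\rho\in\widetilde{\mathbb{R}}_{>0}$. Sets: for a net $(A_\varepsilon)$ of subsets of $\mathbb{R}^n$, $[A_\varepsilon]:=\{[x_\varepsilon] : x_\varepsilon\in A_\varepsilon\text{ for }\varepsilon\text{ small}\}$ and $\langle A_\varepsilon\rangle$ is the set of $[x_\varepsilon]$ such that for every representative one has $x_\varepsilon\in A_\varepsilon$ for $\varepsilon$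 small. $K\subseteq\widetilde{\mathbb{R}}^n$ is functionally compact if $K=[K_\varepsilon]$ for a net of compact sets $K_\varepsilon\subseteq\mathbb{R}^n$ with $\sup_{x\in K_\varepsilon}|x|\le\varepsilon^{-N}$ for $\varepsilon$ small, for some $N\in\mathbb{R}_{>0}$. Generalized smooth functions: $f:X\to Y$ ($X\subseteq\widetilde{\mathbb{R}}^n$, $Y\subseteq\widetilde{\mathbb{R}}^d$) is in $\mathcal{G}^\infty(X,Y)$ if there is a net $u_\varepsilon\in C^\infty(\Omega_\varepsilon,\mathbb{R}^d)$ ($\Omega_\varepsilon$ open) defining $f$: $X\subseteq\langle\Omega_\varepsilon\rangle$, $f([x_\varepsilon])=[u_\varepsilon(x_\varepsilon)]\in Y$ and $(\partial^\alpha u_\varepsilon(x_\varepsilon))$ moderate for all $[x_\varepsilon]\in X$, $\alpha\in\mathbb{N}^n$. If $X$ is sharply open, $\partial^\alpha f([x_\varepsilon]):=[\partial^\alpha u_\varepsilon(x_\varepsilon)]$ is independent of the defining net. Compact supports: $\mathrm{ext}(K):=\{x : \forall a\in K,\ |x-a|>0\}$. For non-empty functionally compact $K\subseteq U$, $\mathcal{GD}_K(U)$ is the set of $f\in\mathcal{G}^\infty(U,\widetilde{\mathbb{R}})$ having a defining net $u_\varepsilon\in C^\infty(\mathbb{R}^n,\mathbb{R})$ with $[\partial^\alpha u_\varepsilon(x_\varepsilon)]=0$ for all $\alpha\in\mathbb{N}^n$ and $[x_\varepsilon]\in\mathrm{ext}(K)$. It is an $\widetilde{\mathbb{R}}$-module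 under pointwise operations. For $f\in\mathcal{GD}_K(U)$ and $m\in\mathbb{N}$, $\|f\|_m:=\max_{|\alpha|\le m}\max_{x\in K}|\partial^\alpha f(x)|\in\widetilde{\mathbb{R}}$ (the maximum over $K$ exists, and the value equals $[\max_{|\alpha|\le m}\sup_{x\in\mathbb{R}^n}|\partial^\alpha u_\varepsilon(x)|]$ for any such net, hence does not depend on $K$). Sharp topology on $\mathcal{GD}_K(U)$: $V$ is sharply open iff for every $v\in V$ there are $m\in\mathbb{N}$, $\rho\in\widetilde{\mathbb{R}}_{>0}$ with $\{g\in\mathcal{GD}_K(U) : \|g-v\|_m<\rho\}\subseteq V$. This topology is a metrizable group topology; completeness means that every sequence that is Cauchy (for all $m\in\mathbb{N}$ and $\rho\in\widetilde{\mathbb{R}}_{>0}$ eventually $\|u_k-u_l\|_m<\rho$) converges. *)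

theory Defs
  imports "HOL-Analysis.Analysis" "HOL-Library.Landau_Symbols"
begin

section \<open>Generalized numbers and points\<close>

text \<open>
  Nets are functions of a real parameter, of which only the values on \<open>(0,1]\<close> are ever relevant;
  ``for \<open>\<epsilon>\<close> small'' is \<^term>\<open>\<lambda>P. eventually P (at_right (0::real))\<close>.
\<close>

definition moderate :: "(real \<Rightarrow> 'a::real_normed_vector) \<Rightarrow> bool" where
  "moderate x \<longleftrightarrow> (\<exists>N::nat. (\<lambda>\<epsilon>. norm (x \<epsilon>)) \<in> O[at_right 0](\<lambda>\<epsilon>. inverse \<epsilon> ^ N))"

definition negligible_net :: "(real \<Rightarrow> 'a::real_normed_vector) \<Rightarrow> bool" where
  "negligible_net x \<longleftrightarrow> (\<forall>m::nat. (\<lambda>\<epsilon>. norm (x \<epsilon>)) \<in> O[at_right 0](\<lambda>\<epsilon>. \<epsilon> ^ m))"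

definition gen_rel :: "(real \<Rightarrow> 'a::real_normed_vector) \<Rightarrow> (real \<Rightarrow> 'a) \<Rightarrow> bool" where
  "gen_rel x y \<longleftrightarrow> moderate x \<and> moderate y \<and> negligible_net (\<lambda>\<epsilon>. x \<epsilon> - y \<epsilon>)"

lemma eventually_small: "d > 0 \<Longrightarrow> \<forall>\<^sub>F \<epsilon> in at_right (0::real). 0 < \<epsilon> \<and> \<epsilon> < d"
  by (auto simp: eventually_at_right_field)

lemma moderate_iff:
  "moderate x \<longleftrightarrow> (\<exists>N::nat. \<forall>\<^sub>F \<epsilon> in at_right 0. norm (x \<epsilon>) \<le> inverse \<epsilon> ^ N)"
proof
  assume "moderate x"
  then obtain N :: nat and C :: real
    where C: "C > 0" "\<forall>\<^sub>F \<epsilon> in at_right 0. norm (norm (x \<epsilon>)) \<le> C * norm (inverse \<epsilon> ^ N)"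
    unfolding moderate_def by (auto elim!: landau_o.bigE)
  have "\<forall>\<^sub>F \<epsilon> in at_right 0. norm (x \<epsilon>) \<le> inverse \<epsilon> ^ Suc N"
    using C(2) eventually_small[OF divide_pos_pos[OF zero_less_one C(1)]]
  proof eventually_elim
    case (elim \<epsilon>)
    with \<open>C > 0\<close> have e: "0 < \<epsilon>" "C \<le> inverse \<epsilon>" by (auto simp: field_simps)
    have "norm (x \<epsilon>) \<le> C * inverse \<epsilon> ^ N" using elim(1) e by simp
    also have "\<dots> \<le> inverse \<epsilon> * inverse \<epsilon> ^ N" using e by (intro mult_right_mono) auto
    finally show ?case by simp
  qed
  then show "\<exists>N::nat. \<forall>\<^sub>F \<epsilon> in at_right 0. norm (x \<epsilon>) \<le> inverse \<epsilon> ^ N" by blast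
next
  assume "\<exists>N::nat. \<forall>\<^sub>F \<epsilon> in at_right 0. norm (x \<epsilon>) \<le> inverse \<epsilon> ^ N"
  then obtain N :: nat where N: "\<forall>\<^sub>F \<epsilon> in at_right 0. norm (x \<epsilon>) \<le> inverse \<epsilon> ^ N" ..
  have "\<forall>\<^sub>F \<epsilon> in at_right 0. norm (norm (x \<epsilon>)) \<le> 1 * norm (inverse \<epsilon> ^ N)"
    using N eventually_small[of 1, simplified] by eventually_elim simp
  then show "moderate x" unfolding moderate_def by (blast intro: landau_o.bigI[of 1])
qed

lemma negligible_net_iff:
  "negligible_net x \<longleftrightarrow> (\<forall>m::nat. \<forall>\<^sub>F \<epsilon> in at_right 0. norm (x \<epsilon>) \<le> \<epsilon> ^ m)"
proof (intro iffI allI)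
  fix m :: nat assume "negligible_net x"
  then have "(\<lambda>\<epsilon>. norm (x \<epsilon>)) \<in> O[at_right 0](\<lambda>\<epsilon>. \<epsilon> ^ Suc m)"
    unfolding negligible_net_def by blast
  then obtain C :: real
    where C: "C > 0" "\<forall>\<^sub>F \<epsilon> in at_right 0. norm (norm (x \<epsilon>)) \<le> C * norm (\<epsilon> ^ Suc m)"
    by (auto elim!: landau_o.bigE)
  show "\<forall>\<^sub>F \<epsilon> in at_right 0. norm (x \<epsilon>) \<le> \<epsilon> ^ m"
    using C(2) eventually_small[OF divide_pos_pos[OF zero_less_one C(1)]]
  proof eventually_elim
    case (elim \<epsilon>)
    with \<open>C > 0\<close> have e: "0 < \<epsilon>" "C * \<epsilon> \<le> 1" by (auto simp: field_simps)
    have "norm (x \<epsilon>) \<le> (C * \<epsilon>) * \<epsilon> ^ m" using elim(1) e by (simp add: mult.assoc)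
    also have "\<dots> \<le> 1 * \<epsilon> ^ m" using e by (intro mult_right_mono) auto
    finally show ?case by simp
  qed
next
  assume N: "\<forall>m::nat. \<forall>\<^sub>F \<epsilon> in at_right 0. norm (x \<epsilon>) \<le> \<epsilon> ^ m"
  have "\<forall>\<^sub>F \<epsilon> in at_right 0. norm (norm (x \<epsilon>)) \<le> 1 * norm (\<epsilon> ^ m)" for m :: nat
    using spec[OF N, of m] eventually_small[of 1, simplified] by eventually_elim simp
  then show "negligible_net x" unfolding negligible_net_def by (blast intro: landau_o.bigI[of 1])
qed

lemma moderate_bound:
  assumes "moderate y" "\<forall>\<^sub>F \<epsilon> in at_right 0. norm (x \<epsilon>) \<le> norm (y \<epsilon>)"
  shows "moderate x"
proof -
  obtain N :: nat where N: "\<forall>\<^sub>F \<epsilon> in at_right 0. norm (y \<epsilon>) \<le> inverse \<epsilon> ^ N"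
    using assms(1) moderate_iff by blast
  have "\<forall>\<^sub>F \<epsilon> in at_right 0. norm (x \<epsilon>) \<le> inverse \<epsilon> ^ N"
    using N assms(2) by eventually_elim auto
  then show ?thesis using moderate_iff by blast
qed

lemma negligible_net_bound:
  assumes "negligible_net y" "\<forall>\<^sub>F \<epsilon> in at_right 0. norm (x \<epsilon>) \<le> norm (y \<epsilon>)"
  shows "negligible_net x"
  unfolding negligible_net_iff
proof
  fix m
  have "\<forall>\<^sub>F \<epsilon> in at_right 0. norm (y \<epsilon>) \<le> \<epsilon> ^ m"
    using assms(1) negligible_net_iff by blast
  then show "\<forall>\<^sub>F \<epsilon> in at_right 0. norm (x \<epsilon>) \<le> \<epsilon> ^ m"
    using assms(2) by eventually_elim auto
qed

lemma moderate_const: "moderate (\<lambda>_. c)"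
proof -
  have "1 / (norm c + 1) > 0" by (simp add: add_nonneg_pos)
  from eventually_small[OF this] have "\<forall>\<^sub>F \<epsilon> in at_right 0. norm c \<le> inverse \<epsilon> ^ 1"
  proof eventually_elim
    case (elim \<epsilon>)
    then have "\<epsilon> * (norm c + 1) < 1" using norm_ge_zero[of c] by (simp add: less_divide_eq)
    then have "\<epsilon> * norm c \<le> 1" using elim by (simp add: distrib_left)
    then show ?case using elim by (simp add: field_simps)
  qed
  then show ?thesis using moderate_iff by blast
qed

lemma negligible_net_zero: "negligible_net (\<lambda>_. 0)"
  unfolding negligible_net_iff
  by (intro allI eventually_mono[OF eventually_small[of 1, simplified]]) simp

lemma moderate_mult_norm:
  assumes "moderate x" "moderate y"
  shows "moderate (\<lambda>\<epsilon>. norm (x \<epsilon>) * norm (y \<epsilon>))"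
proof -
  obtain N M :: nat where N: "\<forall>\<^sub>F \<epsilon> in at_right 0. norm (x \<epsilon>) \<le> inverse \<epsilon> ^ N"
    and M: "\<forall>\<^sub>F \<epsilon> in at_right 0. norm (y \<epsilon>) \<le> inverse \<epsilon> ^ M"
    using assms unfolding moderate_iff by blast
  have "\<forall>\<^sub>F \<epsilon> in at_right 0. norm (norm (x \<epsilon>) * norm (y \<epsilon>)) \<le> inverse \<epsilon> ^ (N + M)"
    using N M eventually_small[of 1, simplified]
    by eventually_elim (auto simp: power_add intro!: mult_mono)
  then show ?thesis using moderate_iff by blast
qed

lemma moderate_add_norm:
  assumes "moderate x" "moderate y"
  shows "moderate (\<lambda>\<epsilon>. norm (x \<epsilon>) + norm (y \<epsilon>))"
proof -
  have *: "moderate (\<lambda>\<epsilon>. 1 + norm (z \<epsilon>))" if z: "moderate z" for z :: "real \<Rightarrow> 'c::real_normed_vector"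
  proof -
    obtain N :: nat where N: "\<forall>\<^sub>F \<epsilon> in at_right 0. norm (z \<epsilon>) \<le> inverse \<epsilon> ^ N"
      using z moderate_iff by blast
    have "\<forall>\<^sub>F \<epsilon> in at_right 0. norm (1 + norm (z \<epsilon>)) \<le> inverse \<epsilon> ^ Suc N"
      using N eventually_small[of "1/2", simplified]
    proof eventually_elim
      case (elim \<epsilon>)
      then have "2 \<le> inverse \<epsilon>" "1 \<le> inverse \<epsilon>" by (auto simp: field_simps)
      then have "1 \<le> inverse \<epsilon> ^ N" by (intro one_le_power)
      moreover have "2 * inverse \<epsilon> ^ N \<le> inverse \<epsilon> * inverse \<epsilon> ^ N"
        using \<open>2 \<le> inverse \<epsilon>\<close> \<open>1 \<le> inverse \<epsilon>\<close> by (intro mult_right_mono zero_le_power) linarith+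
      moreover have "norm (1 + norm (z \<epsilon>)) \<le> 1 + inverse \<epsilon> ^ N" using elim by simp
      ultimately show ?case unfolding power_Suc by linarith
    qed
    then show ?thesis using moderate_iff by blast
  qed
  have "moderate (\<lambda>\<epsilon>. norm (1 + norm (x \<epsilon>)) * norm (1 + norm (y \<epsilon>)))"
    by (intro moderate_mult_norm * assms)
  then show ?thesis
    by (rule moderate_bound) (auto intro!: always_eventually simp: algebra_simps)
qed

lemma moderate_add: "moderate x \<Longrightarrow> moderate y \<Longrightarrow> moderate (\<lambda>\<epsilon>. x \<epsilon> + y \<epsilon>)"
  by (rule moderate_bound[OF moderate_add_norm[of x y]])
     (auto intro!: always_eventually simp: norm_triangle_ineq)

lemma moderate_uminus: "moderate x \<Longrightarrow> moderate (\<lambda>\<epsilon>. - x \<epsilon>)"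
  by (erule moderate_bound) auto

lemma moderate_diff: "moderate x \<Longrightarrow> moderate y \<Longrightarrow> moderate (\<lambda>\<epsilon>. x \<epsilon> - y \<epsilon>)"
  using moderate_add[OF _ moderate_uminus] by fastforce

lemma moderate_mult:
  fixes x y :: "real \<Rightarrow> 'a::real_normed_algebra"
  shows "moderate x \<Longrightarrow> moderate y \<Longrightarrow> moderate (\<lambda>\<epsilon>. x \<epsilon> * y \<epsilon>)"
  by (rule moderate_bound[OF moderate_mult_norm[of x y]])
     (auto intro!: always_eventually simp: norm_mult_ineq)

lemma negligible_net_add_norm:
  assumes "negligible_net x" "negligible_net y"
  shows "negligible_net (\<lambda>\<epsilon>. norm (x \<epsilon>) + norm (y \<epsilon>))"
  unfolding negligible_net_iff
proof
  fix m
  have "\<forall>\<^sub>F \<epsilon> in at_right 0. norm (x \<epsilon>) \<le> \<epsilon> ^ Suc m" "\<forall>\<^sub>F \<epsilon> in at_right 0. norm (y \<epsilon>) \<le> \<epsilon> ^ Suc m"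
    using assms negligible_net_iff by blast+
  then show "\<forall>\<^sub>F \<epsilon> in at_right 0. norm (norm (x \<epsilon>) + norm (y \<epsilon>)) \<le> \<epsilon> ^ m"
    using eventually_small[of "1/2", simplified]
  proof eventually_elim
    case (elim \<epsilon>)
    have "(2 * \<epsilon>) * \<epsilon> ^ m \<le> 1 * \<epsilon> ^ m" using elim by (intro mult_right_mono) auto
    then have "2 * (\<epsilon> ^ Suc m) \<le> \<epsilon> ^ m" by simp
    moreover have "norm (norm (x \<epsilon>) + norm (y \<epsilon>)) = norm (x \<epsilon>) + norm (y \<epsilon>)" by simp
    ultimately show ?case using elim by linarith
  qed
qed

lemma negligible_net_add:
  "negligible_net x \<Longrightarrow> negligible_net y \<Longrightarrow> negligible_net (\<lambda>\<epsilon>. x \<epsilon> + y \<epsilon>)"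
  by (rule negligible_net_bound[OF negligible_net_add_norm[of x y]])
     (auto intro!: always_eventually simp: norm_triangle_ineq)

lemma negligible_net_uminus: "negligible_net x \<Longrightarrow> negligible_net (\<lambda>\<epsilon>. - x \<epsilon>)"
  by (erule negligible_net_bound) auto

lemma negligible_net_mult_norm:
  assumes "negligible_net x" "moderate y"
  shows "negligible_net (\<lambda>\<epsilon>. norm (x \<epsilon>) * norm (y \<epsilon>))"
  unfolding negligible_net_iff
proof
  fix m
  obtain N :: nat where N: "\<forall>\<^sub>F \<epsilon> in at_right 0. norm (y \<epsilon>) \<le> inverse \<epsilon> ^ N"
    using assms moderate_iff by blast
  have "\<forall>\<^sub>F \<epsilon> in at_right 0. norm (x \<epsilon>) \<le> \<epsilon> ^ (m + N)"
    using assms negligible_net_iff by blast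
  then show "\<forall>\<^sub>F \<epsilon> in at_right 0. norm (norm (x \<epsilon>) * norm (y \<epsilon>)) \<le> \<epsilon> ^ m"
    using N eventually_small[of 1, simplified]
  proof eventually_elim
    case (elim \<epsilon>)
    have "norm (x \<epsilon>) * norm (y \<epsilon>) \<le> \<epsilon> ^ (m + N) * inverse \<epsilon> ^ N"
      using elim by (intro mult_mono) auto
    also have "\<dots> = \<epsilon> ^ m" using elim by (simp add: power_add field_simps)
    finally show ?case by simp
  qed
qed

lemma negligible_net_mult:
  fixes x y :: "real \<Rightarrow> 'a::real_normed_algebra"
  assumes "negligible_net x" "moderate y"
  shows "negligible_net (\<lambda>\<epsilon>. x \<epsilon> * y \<epsilon>)" "negligible_net (\<lambda>\<epsilon>. y \<epsilon> * x \<epsilon>)"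
  by (rule negligible_net_bound[OF negligible_net_mult_norm[OF assms]],
      auto intro!: always_eventually intro: norm_mult_ineq
        order_trans[OF norm_mult_ineq] simp: mult.commute[of "norm (x _)"])+

lemma gen_rel_refl: "moderate x \<Longrightarrow> gen_rel x x"
  by (simp add: gen_rel_def negligible_net_zero)

quotient_type (overloaded) 'a gen = "real \<Rightarrow> 'a::real_normed_vector" / partial: gen_rel
proof (rule part_equivpI)
  show "\<exists>x::real \<Rightarrow> 'a. gen_rel x x" using gen_rel_refl moderate_const by blast
  show "symp (gen_rel :: (real \<Rightarrow> 'a) \<Rightarrow> _)"
    by (rule sympI) (use negligible_net_uminus in \<open>fastforce simp: gen_rel_def\<close>)
  show "transp (gen_rel :: (real \<Rightarrow> 'a) \<Rightarrow> _)"
    by (rule transpI) (use negligible_net_add in \<open>fastforce simp: gen_rel_def\<close>)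
qed

definition represents :: "(real \<Rightarrow> 'a::real_normed_vector) \<Rightarrow> 'a gen \<Rightarrow> bool" where
  "represents u x \<longleftrightarrow> moderate u \<and> abs_gen u = x"

lemma represents_rep: "represents (rep_gen x) x"
  using Quotient_rep_reflp[OF Quotient_gen, of x] Quotient_abs_rep[OF Quotient_gen, of x]
  by (auto simp: represents_def gen_rel_def)

lemma represents_unique:
  "represents u x \<Longrightarrow> represents v x \<Longrightarrow> negligible_net (\<lambda>\<epsilon>. u \<epsilon> - v \<epsilon>)"
  using Quotient_rel[OF Quotient_gen, of u v] gen_rel_refl[of u] gen_rel_refl[of v]
  by (auto simp: represents_def gen_rel_def)

instantiation gen :: (real_normed_vector) ab_group_add
begin

lift_definition zero_gen :: "'a gen" is "\<lambda>_. 0" by (simp add: gen_rel_refl moderate_const)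
lift_definition plus_gen :: "'a gen \<Rightarrow> 'a gen \<Rightarrow> 'a gen" is "\<lambda>x y \<epsilon>. x \<epsilon> + y \<epsilon>"
  by (auto simp: gen_rel_def add_diff_add intro: moderate_add negligible_net_add)
lift_definition uminus_gen :: "'a gen \<Rightarrow> 'a gen" is "\<lambda>x \<epsilon>. - x \<epsilon>"
  using negligible_net_uminus
  by (fastforce simp: gen_rel_def intro: moderate_uminus)
definition minus_gen :: "'a gen \<Rightarrow> 'a gen \<Rightarrow> 'a gen" where "minus_gen x y = x + - y"

instance
proof
  fix a b c :: "'a gen"
  show "a + b + c = a + (b + c)"
    by transfer (auto simp: gen_rel_def add.assoc negligible_net_zero intro!: moderate_add)
  show "a + b = b + a"
    by transfer (auto simp: gen_rel_def add.commute negligible_net_zero intro!: moderate_add)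
  show "0 + a = a" by transfer (auto simp: gen_rel_def)
  show "- a + a = 0"
    by transfer (auto simp: gen_rel_def negligible_net_zero moderate_const)
qed (simp add: minus_gen_def)

end

instantiation gen :: (real_normed_field) comm_ring_1
begin

lift_definition one_gen :: "'a gen" is "\<lambda>_. 1" by (simp add: gen_rel_refl moderate_const)
lift_definition times_gen :: "'a gen \<Rightarrow> 'a gen \<Rightarrow> 'a gen" is "\<lambda>x y \<epsilon>. x \<epsilon> * y \<epsilon>"
proof -
  fix x x' y y' :: "real \<Rightarrow> 'a"
  assume *: "gen_rel x x'" "gen_rel y y'"
  have "negligible_net (\<lambda>\<epsilon>. (x \<epsilon> - x' \<epsilon>) * y \<epsilon> + x' \<epsilon> * (y \<epsilon> - y' \<epsilon>))"
    using * by (intro negligible_net_add negligible_net_mult) (auto simp: gen_rel_def)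
  then have "negligible_net (\<lambda>\<epsilon>. x \<epsilon> * y \<epsilon> - x' \<epsilon> * y' \<epsilon>)" by (simp add: algebra_simps)
  then show "gen_rel (\<lambda>\<epsilon>. x \<epsilon> * y \<epsilon>) (\<lambda>\<epsilon>. x' \<epsilon> * y' \<epsilon>)"
    using * by (auto simp: gen_rel_def intro: moderate_mult)
qed

instance
proof
  fix a b c :: "'a gen"
  show "a * b * c = a * (b * c)"
    by transfer (auto simp: gen_rel_def mult.assoc negligible_net_zero intro!: moderate_mult)
  show "a * b = b * a"
    by transfer (auto simp: gen_rel_def mult.commute negligible_net_zero intro!: moderate_mult)
  show "1 * a = a" by transfer (auto simp: gen_rel_def)
  show "(a + b) * c = a * c + b * c"
    by transfer (auto simp: gen_rel_def distrib_right negligible_net_zero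
        intro!: moderate_mult moderate_add)
  have "\<not> negligible_net (\<lambda>_. 1 :: 'a)"
  proof
    assume "negligible_net (\<lambda>_. 1 :: 'a)"
    then have "\<forall>\<^sub>F \<epsilon> in at_right 0. norm (1::'a) \<le> \<epsilon> ^ 1"
      unfolding negligible_net_iff by blast
    then have "\<forall>\<^sub>F \<epsilon> in at_right (0::real). False"
      using eventually_small[of 1, simplified] by eventually_elim auto
    then show False by simp
  qed
  then show "(0::'a gen) \<noteq> 1"
    using negligible_net_uminus[of "\<lambda>_. - 1 :: 'a"] by transfer (auto simp: gen_rel_def)
qed

end

definition gle :: "real gen \<Rightarrow> real gen \<Rightarrow> bool" (infix "\<le>\<^sub>g" 50) where
  "x \<le>\<^sub>g y \<longleftrightarrow> (\<exists>u v. represents u x \<and> represents v y \<and> (\<forall>\<^sub>F \<epsilon> in at_right 0. u \<epsilon> \<le> v \<epsilon>))"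

definition gless :: "real gen \<Rightarrow> real gen \<Rightarrow> bool" (infix "<\<^sub>g" 50) where
  "x <\<^sub>g y \<longleftrightarrow> x \<le>\<^sub>g y \<and> (\<exists>z. (y - x) * z = 1)"

lift_definition gnorm :: "'a::real_normed_vector gen \<Rightarrow> real gen" is "\<lambda>x \<epsilon>. norm (x \<epsilon>)"
proof -
  fix x y :: "real \<Rightarrow> 'a" assume *: "gen_rel x y"
  then have "negligible_net (\<lambda>\<epsilon>. norm (x \<epsilon>) - norm (y \<epsilon>))"
    unfolding gen_rel_def
    by (elim conjE negligible_net_bound) (auto intro!: always_eventually simp: norm_triangle_ineq3)
  moreover have "moderate (\<lambda>\<epsilon>. norm (x \<epsilon>))" "moderate (\<lambda>\<epsilon>. norm (y \<epsilon>))"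
    using * by (auto simp: gen_rel_def elim: moderate_bound)
  ultimately show "gen_rel (\<lambda>\<epsilon>. norm (x \<epsilon>)) (\<lambda>\<epsilon>. norm (y \<epsilon>))" by (simp add: gen_rel_def)
qed

text \<open>
  \<open>\<real>\<close>-valued nets are not totally ordered modulo negligibility, so the maximum of a finite family
  of generalized numbers is the class of the \<open>\<epsilon>\<close>-wise maxima of representatives.
\<close>

definition gMax :: "'i set \<Rightarrow> ('i \<Rightarrow> real gen) \<Rightarrow> real gen" where
  "gMax A g = abs_gen (\<lambda>\<epsilon>. Max ((\<lambda>i. rep_gen (g i) \<epsilon>) ` A))"

definition gmaximum :: "real gen set \<Rightarrow> real gen" where
  "gmaximum S = (THE M. M \<in> S \<and> (\<forall>s\<in>S. s \<le>\<^sub>g M))"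

definition gball :: "'a::real_normed_vector gen \<Rightarrow> real gen \<Rightarrow> 'a gen set" where
  "gball x \<rho> = {y. gnorm (y - x) <\<^sub>g \<rho>}"

definition sharp_topology :: "'a::real_normed_vector gen topology" where
  "sharp_topology = topology_generated_by {gball x \<rho> |x \<rho>. 0 <\<^sub>g \<rho>}"


section \<open>Sets of generalized points\<close>

definition internal_set :: "(real \<Rightarrow> 'a::real_normed_vector set) \<Rightarrow> 'a gen set" where
  "internal_set A = {x. \<exists>u. represents u x \<and> (\<forall>\<^sub>F \<epsilon> in at_right 0. u \<epsilon> \<in> A \<epsilon>)}"

definition strongly_internal_set :: "(real \<Rightarrow> 'a::real_normed_vector set) \<Rightarrow> 'a gen set" where
  "strongly_internal_set A = {x. \<forall>u. represents u x \<longrightarrow> (\<forall>\<^sub>F \<epsilon> in at_right 0. u \<epsilon> \<in> A \<epsilon>)}"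

definition functionally_compact :: "'a::real_normed_vector gen set \<Rightarrow> bool" where
  "functionally_compact K \<longleftrightarrow>
     (\<exists>A. (\<forall>\<epsilon>\<in>{0<..1}. compact (A \<epsilon>)) \<and>
          (\<exists>N>0. \<forall>\<^sub>F \<epsilon> in at_right 0. \<forall>x\<in>A \<epsilon>. norm x \<le> \<epsilon> powr (- N)) \<and>
          K = internal_set A)"

definition gen_ext :: "'a::real_normed_vector gen set \<Rightarrow> 'a gen set" where
  "gen_ext K = {x. \<forall>a\<in>K. 0 <\<^sub>g gnorm (x - a)}"


section \<open>Smooth functions and partial derivatives\<close>

definition pderiv_at :: "'n \<Rightarrow> (real^'n \<Rightarrow> 'b::real_normed_vector) \<Rightarrow> real^'n \<Rightarrow> 'b" where
  "pderiv_at i u x = vector_derivative (\<lambda>t. u (x + t *\<^sub>R axis i 1)) (at 0)"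

primrec Ck_on :: "nat \<Rightarrow> (real^'n) set \<Rightarrow> (real^'n \<Rightarrow> 'b::real_normed_vector) \<Rightarrow> bool" where
  "Ck_on 0 \<Omega> u \<longleftrightarrow> continuous_on \<Omega> u"
| "Ck_on (Suc k) \<Omega> u \<longleftrightarrow> continuous_on \<Omega> u \<and>
     (\<forall>i. (\<forall>x\<in>\<Omega>. (\<lambda>t. u (x + t *\<^sub>R axis i 1)) differentiable (at 0)) \<and> Ck_on k \<Omega> (pderiv_at i u))"

definition smooth_on :: "(real^'n) set \<Rightarrow> (real^'n \<Rightarrow> 'b::real_normed_vector) \<Rightarrow> bool" where
  "smooth_on \<Omega> u \<longleftrightarrow> (\<forall>k. Ck_on k \<Omega> u)"

text \<open>
  A multi-index is a function from the coordinates to \<^typ>\<open>nat\<close>. The coordinate type carries no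
  order, so the iterated derivative runs through an arbitrary enumeration of it; for functions
  smooth on an open set the choice does not affect the value there.
\<close>

definition coords :: "'n::finite list" where
  "coords = (SOME xs. distinct xs \<and> set xs = UNIV)"

definition mpderiv ::
  "('n \<Rightarrow> nat) \<Rightarrow> (real^'n \<Rightarrow> 'b::real_normed_vector) \<Rightarrow> real^'n \<Rightarrow> 'b" where
  "mpderiv \<alpha> u = foldr (\<lambda>i. pderiv_at i ^^ \<alpha> i) coords u"

definition multi_indices_upto :: "nat \<Rightarrow> ('n::finite \<Rightarrow> nat) set" where
  "multi_indices_upto m = {\<alpha>. (\<Sum>i\<in>UNIV. \<alpha> i) \<le> m}"


section \<open>Generalized smooth functions\<close>

definition defines_gsf ::
  "(real \<Rightarrow> (real^'n) set) \<Rightarrow> (real \<Rightarrow> real^'n \<Rightarrow> 'b::real_normed_vector) \<Rightarrow>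
   (real^'n) gen set \<Rightarrow> ((real^'n) gen \<Rightarrow> 'b gen) \<Rightarrow> bool" where
  "defines_gsf \<Omega> u X f \<longleftrightarrow>
     (\<forall>\<epsilon>\<in>{0<..1}. open (\<Omega> \<epsilon>) \<and> smooth_on (\<Omega> \<epsilon>) (u \<epsilon>)) \<and>
     X \<subseteq> strongly_internal_set \<Omega> \<and>
     (\<forall>x\<in>X. \<forall>\<xi>. represents \<xi> x \<longrightarrow>
        represents (\<lambda>\<epsilon>. u \<epsilon> (\<xi> \<epsilon>)) (f x) \<and>
        (\<forall>\<alpha>. moderate (\<lambda>\<epsilon>. mpderiv \<alpha> (u \<epsilon>) (\<xi> \<epsilon>))))"

text \<open>Functions on \<open>X\<close> are extensional, so that equality is equality on \<open>X\<close>.\<close>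

definition GSF ::
  "(real^'n) gen set \<Rightarrow> 'b::real_normed_vector gen set \<Rightarrow> ((real^'n) gen \<Rightarrow> 'b gen) set" where
  "GSF X Y = {f \<in> X \<rightarrow>\<^sub>E Y. \<exists>\<Omega> u. defines_gsf \<Omega> u X f}"

text \<open>
  For sharply open \<open>U\<close> the derivative depends neither on the defining net nor on the
  representative of the point, which is what makes the definite description meaningful.
\<close>

definition gsf_deriv ::
  "(real^'n) gen set \<Rightarrow> ('n \<Rightarrow> nat) \<Rightarrow> ((real^'n) gen \<Rightarrow> 'b::real_normed_vector gen) \<Rightarrow>
   (real^'n) gen \<Rightarrow> 'b gen" where
  "gsf_deriv U \<alpha> f x = (THE y. \<exists>\<Omega> u \<xi>. defines_gsf \<Omega> u U f \<and> represents \<xi> x \<and>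
     represents (\<lambda>\<epsilon>. mpderiv \<alpha> (u \<epsilon>) (\<xi> \<epsilon>)) y)"


section \<open>Compactly supported generalized smooth functions\<close>

definition GD ::
  "(real^'n) gen set \<Rightarrow> (real^'n) gen set \<Rightarrow> ((real^'n) gen \<Rightarrow> real gen) set" where
  "GD K U = {f \<in> GSF U UNIV. \<exists>u. defines_gsf (\<lambda>_. UNIV) u U f \<and>
     (\<forall>x\<in>gen_ext K. \<forall>\<xi>. represents \<xi> x \<longrightarrow>
        (\<forall>\<alpha>. represents (\<lambda>\<epsilon>. mpderiv \<alpha> (u \<epsilon>) (\<xi> \<epsilon>)) 0))}"

definition GD_norm ::
  "(real^'n) gen set \<Rightarrow> (real^'n) gen set \<Rightarrow> nat \<Rightarrow> ((real^'n) gen \<Rightarrow> real gen) \<Rightarrow> real gen" where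
  "GD_norm K U m f =
     gMax (multi_indices_upto m) (\<lambda>\<alpha>. gmaximum ((\<lambda>x. gnorm (gsf_deriv U \<alpha> f x)) ` K))"

definition GD_dist ::
  "(real^'n) gen set \<Rightarrow> (real^'n) gen set \<Rightarrow> nat \<Rightarrow>
   ((real^'n) gen \<Rightarrow> real gen) \<Rightarrow> ((real^'n) gen \<Rightarrow> real gen) \<Rightarrow> real gen" where
  "GD_dist K U m f g = GD_norm K U m (\<lambda>x\<in>U. f x - g x)"

definition GD_open ::
  "(real^'n) gen set \<Rightarrow> (real^'n) gen set \<Rightarrow> ((real^'n) gen \<Rightarrow> real gen) set \<Rightarrow> bool" where
  "GD_open K U V \<longleftrightarrow> V \<subseteq> GD K U \<and>
     (\<forall>v\<in>V. \<exists>m \<rho>. 0 <\<^sub>g \<rho> \<and> {g \<in> GD K U. GD_dist K U m g v <\<^sub>g \<rho>} \<subseteq> V)"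

definition GD_topology ::
  "(real^'n) gen set \<Rightarrow> (real^'n) gen set \<Rightarrow> ((real^'n) gen \<Rightarrow> real gen) topology" where
  "GD_topology K U = topology (GD_open K U)"

definition GD_Cauchy ::
  "(real^'n) gen set \<Rightarrow> (real^'n) gen set \<Rightarrow> (nat \<Rightarrow> (real^'n) gen \<Rightarrow> real gen) \<Rightarrow> bool" where
  "GD_Cauchy K U f \<longleftrightarrow> range f \<subseteq> GD K U \<and>
     (\<forall>m \<rho>. 0 <\<^sub>g \<rho> \<longrightarrow> (\<exists>N. \<forall>k\<ge>N. \<forall>l\<ge>N. GD_dist K U m (f k) (f l) <\<^sub>g \<rho>))"

definition GD_complete :: "(real^'n) gen set \<Rightarrow> (real^'n) gen set \<Rightarrow> bool" where
  "GD_complete K U \<longleftrightarrow>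
     (\<forall>f. GD_Cauchy K U f \<longrightarrow> (\<exists>g. limitin (GD_topology K U) f g sequentially))"


section \<open>The sharp topology is a topology\<close>

lemma represents_minus:
  assumes "represents u x" "represents v y"
  shows "represents (\<lambda>\<epsilon>. u \<epsilon> - v \<epsilon>) (x - y)"
proof -
  have m: "moderate u" "moderate v" "moderate (\<lambda>\<epsilon>. - v \<epsilon>)"
    using assms by (auto simp: represents_def intro: moderate_uminus)
  then have "x - y = abs_gen (\<lambda>\<epsilon>. u \<epsilon> + - v \<epsilon>)"
    using assms plus_gen.abs_eq[of u "\<lambda>\<epsilon>. - v \<epsilon>"] uminus_gen.abs_eq[of v]
    by (simp add: represents_def minus_gen_def gen_rel_refl)
  with m show ?thesis by (simp add: represents_def moderate_diff)
qed

lemma represents_times: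
  fixes u v :: "real \<Rightarrow> 'a::real_normed_field"
  shows "represents u x \<Longrightarrow> represents v y \<Longrightarrow> represents (\<lambda>\<epsilon>. u \<epsilon> * v \<epsilon>) (x * y)"
  using times_gen.abs_eq[of u v] by (auto simp: represents_def gen_rel_refl moderate_mult)

lemma gless_iff:
  assumes "represents u x" "represents v y"
  shows "x <\<^sub>g y \<longleftrightarrow> (\<exists>q::nat. \<forall>\<^sub>F \<epsilon> in at_right 0. \<epsilon> ^ q \<le> v \<epsilon> - u \<epsilon>)"
proof
  assume "x <\<^sub>g y"
  then obtain u' v' z where r: "represents u' x" "represents v' y"
    and le: "\<forall>\<^sub>F \<epsilon> in at_right 0. u' \<epsilon> \<le> v' \<epsilon>" and z: "(y - x) * z = 1"
    by (auto simp: gless_def gle_def)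
  define w where "w = rep_gen z"
  have w: "represents w z" by (simp add: w_def represents_rep)
  have "represents (\<lambda>\<epsilon>. (v \<epsilon> - u \<epsilon>) * w \<epsilon>) ((y - x) * z)"
    by (intro represents_times represents_minus assms w)
  then have "represents (\<lambda>\<epsilon>. (v \<epsilon> - u \<epsilon>) * w \<epsilon>) 1" by (simp only: z)
  moreover have "represents (\<lambda>_. 1) (1 :: real gen)"
    by (simp add: represents_def moderate_const one_gen.abs_eq)
  ultimately have n1: "negligible_net (\<lambda>\<epsilon>. (v \<epsilon> - u \<epsilon>) * w \<epsilon> - 1)"
    by (rule represents_unique)
  have n2: "negligible_net (\<lambda>\<epsilon>. u' \<epsilon> - u \<epsilon>)" "negligible_net (\<lambda>\<epsilon>. v' \<epsilon> - v \<epsilon>)"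
    using represents_unique[OF r(1) assms(1)] represents_unique[OF r(2) assms(2)] by auto
  obtain N :: nat where N: "\<forall>\<^sub>F \<epsilon> in at_right 0. norm (w \<epsilon>) \<le> inverse \<epsilon> ^ N"
    using w unfolding moderate_iff represents_def by blast
  have "\<forall>\<^sub>F \<epsilon> in at_right 0. norm ((v \<epsilon> - u \<epsilon>) * w \<epsilon> - 1) \<le> \<epsilon> ^ 1"
    "\<forall>\<^sub>F \<epsilon> in at_right 0. norm (u' \<epsilon> - u \<epsilon>) \<le> \<epsilon> ^ (N + 2)"
    "\<forall>\<^sub>F \<epsilon> in at_right 0. norm (v' \<epsilon> - v \<epsilon>) \<le> \<epsilon> ^ (N + 2)"
    using n1 n2 unfolding negligible_net_iff by blast+
  then have "\<forall>\<^sub>F \<epsilon> in at_right 0. \<epsilon> ^ (N + 1) \<le> v \<epsilon> - u \<epsilon>"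
    using N le eventually_small[of "1/2", simplified]
  proof eventually_elim
    case (elim \<epsilon>)
    define d where "d = v \<epsilon> - u \<epsilon>"
    have e: "0 < \<epsilon>" "\<epsilon> < 1/2" using elim by auto
    have p: "0 < \<epsilon> ^ N" using e by simp
    have "1/2 \<le> d * w \<epsilon>" using elim(1) e by (simp add: d_def abs_if split: if_splits)
    also have "\<dots> \<le> \<bar>d\<bar> * \<bar>w \<epsilon>\<bar>" by (metis abs_ge_self abs_mult)
    also have "\<dots> \<le> \<bar>d\<bar> * inverse \<epsilon> ^ N" using elim by (intro mult_left_mono) auto
    finally have "\<epsilon> ^ N / 2 \<le> \<bar>d\<bar>" using p by (simp add: field_simps)
    moreover have "\<epsilon> * \<epsilon> ^ N \<le> 1/2 * \<epsilon> ^ N" using e p by (intro mult_right_mono) auto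
    moreover have "- d \<le> 2 * \<epsilon> ^ (N + 2)" using elim by (simp add: d_def abs_if split: if_splits)
    moreover have "2 * \<epsilon> ^ (N + 2) < \<epsilon> ^ N / 2"
    proof -
      have "\<epsilon> * \<epsilon> < 1/2 * (1/2)" using e by (intro mult_strict_mono) auto
      then have "\<epsilon> * \<epsilon> * \<epsilon> ^ N < 1/4 * \<epsilon> ^ N" using p by (intro mult_strict_right_mono) auto
      then show ?thesis by (simp add: power_add power2_eq_square algebra_simps)
    qed
    ultimately show ?case by (auto simp: d_def[symmetric] abs_if split: if_splits)
  qed
  then show "\<exists>q::nat. \<forall>\<^sub>F \<epsilon> in at_right 0. \<epsilon> ^ q \<le> v \<epsilon> - u \<epsilon>" by blast
next
  assume "\<exists>q::nat. \<forall>\<^sub>F \<epsilon> in at_right 0. \<epsilon> ^ q \<le> v \<epsilon> - u \<epsilon>"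
  then obtain q :: nat where q: "\<forall>\<^sub>F \<epsilon> in at_right 0. \<epsilon> ^ q \<le> v \<epsilon> - u \<epsilon>" ..
  have pos: "\<forall>\<^sub>F \<epsilon> in at_right 0. 0 < v \<epsilon> - u \<epsilon> \<and> inverse (v \<epsilon> - u \<epsilon>) \<le> inverse \<epsilon> ^ q"
    using q eventually_small[of 1, simplified]
  proof eventually_elim
    case (elim \<epsilon>)
    then have "0 < \<epsilon> ^ q" by simp
    moreover from this have "0 < v \<epsilon> - u \<epsilon>" using elim by linarith
    ultimately show ?case
      using elim le_imp_inverse_le[of "\<epsilon> ^ q" "v \<epsilon> - u \<epsilon>"] by (simp add: power_inverse)
  qed
  define w where "w = (\<lambda>\<epsilon>. inverse (v \<epsilon> - u \<epsilon>))"
  have "\<forall>\<^sub>F \<epsilon> in at_right 0. norm (w \<epsilon>) \<le> inverse \<epsilon> ^ q"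
    using pos by eventually_elim (auto simp: w_def)
  then have w: "moderate w" using moderate_iff by blast
  have "represents w (abs_gen w)" using w by (simp add: represents_def)
  then have r: "represents (\<lambda>\<epsilon>. (v \<epsilon> - u \<epsilon>) * w \<epsilon>) ((y - x) * abs_gen w)"
    by (intro represents_times represents_minus assms)
  have "negligible_net (\<lambda>\<epsilon>. (v \<epsilon> - u \<epsilon>) * w \<epsilon> - 1)"
    by (rule negligible_net_bound[OF negligible_net_zero])
       (use pos in \<open>eventually_elim, auto simp: w_def\<close>)
  then have "gen_rel (\<lambda>\<epsilon>. (v \<epsilon> - u \<epsilon>) * w \<epsilon>) (\<lambda>_. 1)"
    using r by (simp add: gen_rel_def represents_def moderate_const)
  then have "abs_gen (\<lambda>\<epsilon>. (v \<epsilon> - u \<epsilon>) * w \<epsilon>) = abs_gen (\<lambda>_. 1)"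
    using Quotient_rel_abs[OF Quotient_gen] by blast
  with r have "(y - x) * abs_gen w = 1" by (simp add: one_gen.abs_eq represents_def)
  moreover have "\<forall>\<^sub>F \<epsilon> in at_right 0. u \<epsilon> \<le> v \<epsilon>" using pos by eventually_elim auto
  then have "x \<le>\<^sub>g y" unfolding gle_def using assms by blast
  ultimately show "x <\<^sub>g y" by (auto simp: gless_def)
qed

lemma gless_trans_gle:
  assumes "x \<le>\<^sub>g y" "y <\<^sub>g z" shows "x <\<^sub>g z"
proof -
  obtain u v where r: "represents u x" "represents v y" and le: "\<forall>\<^sub>F \<epsilon> in at_right 0. u \<epsilon> \<le> v \<epsilon>"
    using assms by (auto simp: gle_def)
  obtain q :: nat where q: "\<forall>\<^sub>F \<epsilon> in at_right 0. \<epsilon> ^ q \<le> rep_gen z \<epsilon> - v \<epsilon>"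
    using gless_iff[OF r(2) represents_rep] assms by blast
  have "\<forall>\<^sub>F \<epsilon> in at_right 0. \<epsilon> ^ q \<le> rep_gen z \<epsilon> - u \<epsilon>"
    using q le by eventually_elim auto
  then show ?thesis unfolding gless_iff[OF r(1) represents_rep] by blast
qed

lemma gless_lower_bound:
  assumes "0 <\<^sub>g \<rho>1" "0 <\<^sub>g \<rho>2"
  obtains \<rho> where "0 <\<^sub>g \<rho>" "\<And>x. x <\<^sub>g \<rho> \<Longrightarrow> x <\<^sub>g \<rho>1 \<and> x <\<^sub>g \<rho>2"
proof -
  define u v where "u = rep_gen \<rho>1" and "v = rep_gen \<rho>2"
  have r: "represents u \<rho>1" "represents v \<rho>2" by (simp_all add: u_def v_def represents_rep)
  define w where "w = (\<lambda>\<epsilon>. min (u \<epsilon>) (v \<epsilon>))"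
  have "moderate (\<lambda>\<epsilon>. norm (u \<epsilon>) + norm (v \<epsilon>))"
    using r by (intro moderate_add_norm) (auto simp: represents_def)
  then have "moderate w"
    by (rule moderate_bound) (auto simp: w_def min_def intro!: always_eventually)
  then have w: "represents w (abs_gen w)" by (simp add: represents_def)
  have z: "represents (\<lambda>_. 0) (0 :: real gen)"
    by (simp add: represents_def moderate_const zero_gen.abs_eq)
  obtain p q :: nat where "\<forall>\<^sub>F \<epsilon> in at_right 0. \<epsilon> ^ p \<le> u \<epsilon> - 0"
    "\<forall>\<^sub>F \<epsilon> in at_right 0. \<epsilon> ^ q \<le> v \<epsilon> - 0"
    using gless_iff[OF z r(1)] gless_iff[OF z r(2)] assms by blast
  then have "\<forall>\<^sub>F \<epsilon> in at_right 0. \<epsilon> ^ (p + q) \<le> w \<epsilon> - 0"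
    using eventually_small[of 1, simplified]
  proof eventually_elim
    case (elim \<epsilon>)
    then have "\<epsilon> ^ (p + q) \<le> \<epsilon> ^ p" "\<epsilon> ^ (p + q) \<le> \<epsilon> ^ q"
      by (auto intro!: power_decreasing)
    then have "\<epsilon> ^ (p + q) \<le> u \<epsilon>" "\<epsilon> ^ (p + q) \<le> v \<epsilon>" using elim by linarith+
    then show ?case by (simp add: w_def)
  qed
  then have "0 <\<^sub>g abs_gen w" using gless_iff[OF z w] by blast
  moreover have "x <\<^sub>g \<rho>1 \<and> x <\<^sub>g \<rho>2" if x: "x <\<^sub>g abs_gen w" for x
  proof -
    obtain q :: nat where q: "\<forall>\<^sub>F \<epsilon> in at_right 0. \<epsilon> ^ q \<le> w \<epsilon> - rep_gen x \<epsilon>"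
      using x unfolding gless_iff[OF represents_rep w] ..
    have "\<forall>\<^sub>F \<epsilon> in at_right 0. \<epsilon> ^ q \<le> u \<epsilon> - rep_gen x \<epsilon>"
      "\<forall>\<^sub>F \<epsilon> in at_right 0. \<epsilon> ^ q \<le> v \<epsilon> - rep_gen x \<epsilon>"
      using q by (eventually_elim, simp add: w_def)+
    then show ?thesis
      unfolding gless_iff[OF represents_rep r(1)] gless_iff[OF represents_rep r(2)] by blast
  qed
  ultimately show ?thesis using that by blast
qed

lemma finite_multi_indices: "finite (multi_indices_upto m :: ('n::finite \<Rightarrow> nat) set)"
proof (rule finite_subset)
  show "multi_indices_upto m \<subseteq> (UNIV::'n set) \<rightarrow>\<^sub>E {..m}"
  proof
    fix \<alpha> :: "'n \<Rightarrow> nat" assume "\<alpha> \<in> multi_indices_upto m"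
    then have "\<alpha> i \<le> m" for i
      using member_le_sum[of i UNIV \<alpha>] by (auto simp: multi_indices_upto_def)
    then show "\<alpha> \<in> (UNIV::'n set) \<rightarrow>\<^sub>E {..m}" by auto
  qed
qed (auto intro: finite_PiE)

lemma represents_gMax:
  assumes "finite A" "A \<noteq> {}"
  shows "represents (\<lambda>\<epsilon>. Max ((\<lambda>i. rep_gen (g i) \<epsilon>) ` A)) (gMax A g)"
proof -
  have "moderate (\<lambda>\<epsilon>. Max ((\<lambda>i. rep_gen (g i) \<epsilon>) ` A))"
    using assms
  proof (induction rule: finite_ne_induct)
    case (singleton i)
    then show ?case using represents_rep[of "g i"] by (simp add: represents_def)
  next
    case (insert i F)
    have "moderate (\<lambda>\<epsilon>. norm (rep_gen (g i) \<epsilon>) + norm (Max ((\<lambda>i. rep_gen (g i) \<epsilon>) ` F)))"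
      using represents_rep[of "g i"] insert by (intro moderate_add_norm) (auto simp: represents_def)
    then show ?case
      by (rule moderate_bound) (use insert in \<open>auto simp: max_def intro!: always_eventually\<close>)
  qed
  then show ?thesis by (simp add: represents_def gMax_def)
qed

lemma GD_norm_mono:
  fixes K U :: "(real^'n) gen set"
  assumes "m \<le> m'"
  shows "GD_norm K U m f \<le>\<^sub>g GD_norm K U m' f"
proof -
  have ne: "multi_indices_upto k \<noteq> ({} :: ('n \<Rightarrow> nat) set)" for k
    by (auto simp: multi_indices_upto_def intro!: exI[of _ "\<lambda>_. 0"])
  have "multi_indices_upto m \<subseteq> (multi_indices_upto m' :: ('n \<Rightarrow> nat) set)"
    using assms by (auto simp: multi_indices_upto_def)
  then have mono: "Max (h ` (multi_indices_upto m :: ('n \<Rightarrow> nat) set)) \<le> Max (h ` multi_indices_upto m')"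
    for h :: "('n \<Rightarrow> nat) \<Rightarrow> real"
    by (intro Max_mono image_mono) (auto simp: ne finite_multi_indices)
  show ?thesis
    unfolding GD_norm_def gle_def
    by (rule exI, rule exI, intro conjI, rule represents_gMax[OF finite_multi_indices ne],
        rule represents_gMax[OF finite_multi_indices ne], intro always_eventually allI mono)
qed

lemma istopology_GD_open: "istopology (GD_open K U)"
  unfolding istopology_def
proof (intro conjI allI impI)
  fix S T assume S: "GD_open K U S" and T: "GD_open K U T"
  show "GD_open K U (S \<inter> T)"
    unfolding GD_open_def
  proof (intro conjI ballI)
    fix v assume "v \<in> S \<inter> T"
    then have v: "v \<in> S" "v \<in> T" by auto
    from S v(1) obtain m1 \<rho>1 where 1: "0 <\<^sub>g \<rho>1" "{g \<in> GD K U. GD_dist K U m1 g v <\<^sub>g \<rho>1} \<subseteq> S"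
      unfolding GD_open_def by blast
    from T v(2) obtain m2 \<rho>2 where 2: "0 <\<^sub>g \<rho>2" "{g \<in> GD K U. GD_dist K U m2 g v <\<^sub>g \<rho>2} \<subseteq> T"
      unfolding GD_open_def by blast
    obtain \<rho> where \<rho>: "0 <\<^sub>g \<rho>" "\<And>x. x <\<^sub>g \<rho> \<Longrightarrow> x <\<^sub>g \<rho>1 \<and> x <\<^sub>g \<rho>2"
      using gless_lower_bound[OF 1(1) 2(1)] by blast
    have mono: "GD_dist K U m1 g v \<le>\<^sub>g GD_dist K U (max m1 m2) g v"
      "GD_dist K U m2 g v \<le>\<^sub>g GD_dist K U (max m1 m2) g v" for g
      unfolding GD_dist_def by (rule GD_norm_mono; simp)+
    have "{g \<in> GD K U. GD_dist K U (max m1 m2) g v <\<^sub>g \<rho>} \<subseteq> S \<inter> T"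
      using 1(2) 2(2) \<rho>(2) gless_trans_gle[OF mono(1)] gless_trans_gle[OF mono(2)] by blast
    then show "\<exists>m \<rho>. 0 <\<^sub>g \<rho> \<and> {g \<in> GD K U. GD_dist K U m g v <\<^sub>g \<rho>} \<subseteq> S \<inter> T"
      using \<rho>(1) by blast
  qed (use S in \<open>auto simp: GD_open_def\<close>)
next
  fix \<K> assume "\<forall>S\<in>\<K>. GD_open K U S"
  note \<K> = this
  show "GD_open K U (\<Union>\<K>)"
    unfolding GD_open_def
  proof (intro conjI ballI)
    fix v assume "v \<in> \<Union>\<K>"
    then obtain S where S: "S \<in> \<K>" "v \<in> S" by blast
    with \<K> obtain m \<rho> where "0 <\<^sub>g \<rho>" "{g \<in> GD K U. GD_dist K U m g v <\<^sub>g \<rho>} \<subseteq> S"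
      unfolding GD_open_def by blast
    then show "\<exists>m \<rho>. 0 <\<^sub>g \<rho> \<and> {g \<in> GD K U. GD_dist K U m g v <\<^sub>g \<rho>} \<subseteq> \<Union>\<K>"
      using S(1) by blast
  qed (use \<K> in \<open>auto simp: GD_open_def\<close>)
qed

lemma openin_GD_topology: "openin (GD_topology K U) V \<longleftrightarrow> GD_open K U V"
  unfolding GD_topology_def topology_inverse'[OF istopology_GD_open] ..

lemma topspace_GD_topology: "topspace (GD_topology K U) = GD K U"
proof -
  have z: "represents (\<lambda>_. 0) (0 :: real gen)" and o: "represents (\<lambda>_. 1) (1 :: real gen)"
    by (simp_all add: represents_def moderate_const zero_gen.abs_eq one_gen.abs_eq)
  have "\<forall>\<^sub>F \<epsilon> in at_right (0::real). \<epsilon> ^ 0 \<le> 1 - (0::real)" by simp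
  then have "0 <\<^sub>g 1" unfolding gless_iff[OF z o] by blast
  then have "GD_open K U (GD K U)" by (auto simp: GD_open_def)
  then show ?thesis
    unfolding topspace_def openin_GD_topology by (auto simp: GD_open_def)
qed

end

theory Submission
  imports Defs
begin

text \<open>
  If \<open>||h||\<^sub>m\<close> is below \<open>[\<epsilon>^k]\<close>, a defining net of \<open>h\<close> that is negligible on \<open>ext(K)\<close> has its
  derivatives of order at most \<open>m\<close> bounded by \<open>\<epsilon>^k\<close> on every ball of radius \<open>\<epsilon>^(-M)\<close> for small
  \<open>\<epsilon>\<close>: a violating net would be, along a subsequence, either infinitely close to \<open>K\<close> or in \<open>ext(K)\<close>.
  Given a Cauchy sequence with nets \<open>u\<^sub>k\<close> (after passing to a subsequence), the limit is then
  the diagonal net \<open>u\<^bsub>\<kappa>(\<epsilon>)\<^esub>\<close> at \<open>\<epsilon>\<close>, where \<open>\<kappa>(\<epsilon>)\<close> grows slowly enough that all of the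
  finitely many estimates between \<open>u\<^sub>0, \<dots>, u\<^bsub>\<kappa>(\<epsilon>)\<^esub>\<close> hold at \<open>\<epsilon>\<close>. It is smooth for trivial
  reasons, so no limit of derivatives has to be interchanged.
\<close>

text \<open>Seminorms and the condition on ext(K) control single nets of points, whereas
  interpolation along a segment and the diagonal choice need bounds for all points at one
  \<epsilon>; every passage between the two is an instance of \<open>nets_uniform\<close>. Points
  are classes of moderate nets, so these data reach no further than balls of radius \<epsilon>^(-M).
  This is enough, because in the diagonal estimate one index k serves as order of differentiation,
  exponent of the radius and exponent of the accuracy: each multi-index and each moderate net is
  covered from some k on.

  The other obstacle is that \<open>gsf_deriv\<close> is a definite description: before a seminorm
  can be computed from a given net, values negligible on a sharply open set must be shown to have
  negligible derivatives. A derivative is bounded by a difference quotient of step h plus h times a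
  bound of the second derivative. For h = \<epsilon>^p the quotient is negligible because the values
  are, the remainder is small for large p because second derivatives are moderate, and sharp
  openness leaves room for the step.\<close>

section \<open>Uniformity over nets and diagonal choice\<close>

text \<open>
  A property of all nets constrained by \<open>P\<close> holds uniformly in the points: points violating it for
  a sequence of parameters tending to 0 are interpolated by \<open>d\<close> to a net.
\<close>

lemma nets_uniform:
  fixes P G :: "nat \<Rightarrow> real \<Rightarrow> 'a \<Rightarrow> bool"
  assumes P: "\<And>p q \<epsilon> x. p \<le> q \<Longrightarrow> 0 < \<epsilon> \<Longrightarrow> \<epsilon> < 1 \<Longrightarrow> P q \<epsilon> x \<Longrightarrow> P p \<epsilon> x"
    and G: "\<And>p q \<epsilon> x. p \<le> q \<Longrightarrow> 0 < \<epsilon> \<Longrightarrow> \<epsilon> < 1 \<Longrightarrow> G p \<epsilon> x \<Longrightarrow> G q \<epsilon> x"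
    and d: "\<And>q. \<forall>\<^sub>F \<epsilon> in at_right 0. P q \<epsilon> (d \<epsilon>)"
    and nets: "\<And>\<xi>. (\<And>q. \<forall>\<^sub>F \<epsilon> in at_right 0. P q \<epsilon> (\<xi> \<epsilon>)) \<Longrightarrow>
      \<exists>q. \<forall>\<^sub>F \<epsilon> in at_right 0. G q \<epsilon> (\<xi> \<epsilon>)"
  shows "\<exists>q. \<forall>\<^sub>F \<epsilon> in at_right 0. \<forall>x. P q \<epsilon> x \<longrightarrow> G q \<epsilon> x"
proof (rule ccontr)
  assume "\<not> ?thesis"
  then have fr: "\<not> (\<forall>\<^sub>F \<epsilon> in at_right 0. \<forall>x. P q \<epsilon> x \<longrightarrow> G q \<epsilon> x)" for q by blast
  \<comment> \<open>One index for both: the n-th bad point meets the n-th constraint and still fails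
    the n-th conclusion. As conclusions weaken with n, no single q can hold along the interpolating
    net.\<close>
  define bad where "bad n \<epsilon> x \<longleftrightarrow> P n \<epsilon> x \<and> \<not> G n \<epsilon> x" for n \<epsilon> x
  have ex: "\<exists>\<epsilon>. 0 < \<epsilon> \<and> \<epsilon> < \<delta> \<and> (\<exists>x. bad q \<epsilon> x)" if "\<delta> > 0" for q \<delta>
  proof (rule ccontr)
    assume *: "\<not> ?thesis"
    have "\<forall>\<^sub>F \<epsilon> in at_right 0. \<forall>x. P q \<epsilon> x \<longrightarrow> G q \<epsilon> x"
      using eventually_small[OF that] by eventually_elim (use * in \<open>auto simp: bad_def\<close>)
    then show False using fr by blast
  qed
  \<comment> \<open>Strict decrease makes \<open>e\<close> injective, so that \<open>\<xi>\<close>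
    can be defined by \<open>inv e\<close>, and makes \<epsilon> < \<open>e q\<close> single out the
    indices beyond q.\<close>
  have "\<exists>e. \<forall>n. (0 < e n \<and> e n < 1 / real (Suc n) \<and> (\<exists>x. bad n (e n) x)) \<and> e (Suc n) < e n"
  proof (rule dependent_nat_choice)
    show "\<exists>\<epsilon>. 0 < \<epsilon> \<and> \<epsilon> < 1 / real (Suc 0) \<and> (\<exists>x. bad 0 \<epsilon> x)"
      using ex[of 1 0] by simp
  next
    fix \<epsilon> n assume "0 < \<epsilon> \<and> \<epsilon> < 1 / real (Suc n) \<and> (\<exists>x. bad n \<epsilon> x)"
    then show "\<exists>y. (0 < y \<and> y < 1 / real (Suc (Suc n)) \<and> (\<exists>x. bad (Suc n) y x)) \<and> y < \<epsilon>"
      using ex[of "min \<epsilon> (1 / real (Suc (Suc n)))" "Suc n"] by auto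
  qed
  then obtain e where e: "\<And>n. 0 < e n" "\<And>n. e n < 1 / real (Suc n)" "\<And>n. e (Suc n) < e n"
    and "\<And>n. \<exists>x. bad n (e n) x" by blast
  then obtain X where X: "\<And>n. bad n (e n) (X n)" by metis
  have dec: "e n < e m" if "m < n" for m n
    using lift_Suc_mono_less[of "\<lambda>n. - e n" m n] e(3) that by simp
  have dec': "e n < e m \<longleftrightarrow> m < n" for m n
    using dec[of m n] dec[of n m] by (cases m n rule: linorder_cases) auto
  have inj: "inj e" using dec by (metis injI less_irrefl linorder_neqE_nat)
  have e1: "e n < 1" for n
  proof -
    have "1 / real (Suc n) \<le> 1" by simp
    then show ?thesis using e(2)[of n] by linarith
  qed
  define \<xi> where "\<xi> \<epsilon> = (if \<epsilon> \<in> range e then X (inv e \<epsilon>) else d \<epsilon>)" for \<epsilon>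
  have \<xi>e: "\<xi> (e n) = X n" for n using inj by (simp add: \<xi>_def)
  have "\<forall>\<^sub>F \<epsilon> in at_right 0. P q \<epsilon> (\<xi> \<epsilon>)" for q
    using d[of q] eventually_small[OF e(1)[of q]]
  proof eventually_elim
    case (elim \<epsilon>)
    show ?case
    proof (cases "\<epsilon> \<in> range e")
      case True
      then obtain n where n: "\<epsilon> = e n" by blast
      with elim have "q \<le> n" using dec' by (simp add: less_imp_le)
      moreover have "P n (e n) (X n)" using X by (simp add: bad_def)
      ultimately show ?thesis using P e(1) e1 by (simp add: n \<xi>e)
    qed (use elim in \<open>simp add: \<xi>_def\<close>)
  qed
  then obtain q where "\<forall>\<^sub>F \<epsilon> in at_right 0. G q \<epsilon> (\<xi> \<epsilon>)" using nets by blast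
  then obtain \<delta> where \<delta>: "\<delta> > 0" "\<And>\<epsilon>. 0 < \<epsilon> \<Longrightarrow> \<epsilon> < \<delta> \<Longrightarrow> G q \<epsilon> (\<xi> \<epsilon>)"
    unfolding eventually_at_right_field by blast
  obtain n0 where n0: "inverse (real (Suc n0)) < \<delta>" using reals_Archimedean[OF \<delta>(1)] by blast
  define n where "n = max n0 q"
  have "1 / real (Suc n) \<le> 1 / real (Suc n0)" by (intro divide_left_mono) (auto simp: n_def)
  then have "e n < \<delta>" using e(2)[of n] n0 by (simp add: inverse_eq_divide)
  then have "G q (e n) (X n)" using \<delta>(2)[OF e(1), of n] by (simp add: \<xi>e)
  then have "G n (e n) (X n)" using G[of q n] e(1) e1 by (simp add: n_def)
  then show False using X by (auto simp: bad_def)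
qed

text \<open>\<open>\<kappa> \<epsilon>\<close> is the largest l \<le> 1/\<epsilon> with
  \<open>P l \<epsilon>\<close>. The cap keeps the candidates finite in number and excludes no fixed
  k once \<epsilon> is small, so \<kappa> still tends to infinity.\<close>

lemma eventually_diagonal:
  fixes P :: "nat \<Rightarrow> real \<Rightarrow> bool"
  assumes "\<And>l. \<forall>\<^sub>F \<epsilon> in at_right 0. P l \<epsilon>"
  obtains \<kappa> where "\<And>k. \<forall>\<^sub>F \<epsilon> in at_right 0. k \<le> \<kappa> \<epsilon>" "\<forall>\<^sub>F \<epsilon> in at_right 0. P (\<kappa> \<epsilon>) \<epsilon>"
proof -
  define T where "T \<epsilon> = {l. real l \<le> 1 / \<epsilon> \<and> P l \<epsilon>}" for \<epsilon>
  define \<kappa> where "\<kappa> \<epsilon> = Max (T \<epsilon>)" for \<epsilon>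
  have fin: "finite (T \<epsilon>)" for \<epsilon>
    by (rule finite_subset[of _ "{..nat \<lfloor>1 / \<epsilon>\<rfloor>}"]) (auto simp: T_def le_nat_floor)
  have inT: "\<forall>\<^sub>F \<epsilon> in at_right 0. k \<in> T \<epsilon>" for k
  proof -
    have "1 / (real k + 1) > 0" by simp
    from assms[of k] eventually_small[OF this] show ?thesis
    proof eventually_elim
      case (elim \<epsilon>)
      then have "\<epsilon> * (real k + 1) < 1" by (simp add: less_divide_eq)
      then have "real k * \<epsilon> \<le> 1" using elim by (simp add: algebra_simps)
      then show ?case using elim by (simp add: T_def le_divide_eq)
    qed
  qed
  show ?thesis
  proof
    show "\<forall>\<^sub>F \<epsilon> in at_right 0. k \<le> \<kappa> \<epsilon>" for k
      using inT[of k] by eventually_elim (simp add: \<kappa>_def fin)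
    show "\<forall>\<^sub>F \<epsilon> in at_right 0. P (\<kappa> \<epsilon>) \<epsilon>"
      using inT[of 0]
    proof eventually_elim
      case (elim \<epsilon>)
      then have "\<kappa> \<epsilon> \<in> T \<epsilon>" unfolding \<kappa>_def using fin by (intro Max_in) auto
      then show ?case by (simp add: T_def)
    qed
  qed
qed

section \<open>Representatives, order and finite maxima\<close>

lemma represents_abs_gen: "moderate u \<Longrightarrow> represents u (abs_gen u)"
  by (simp add: represents_def)

lemma moderate_power: "moderate (\<lambda>\<epsilon>::real. \<epsilon> ^ k)"
proof -
  have "\<forall>\<^sub>F \<epsilon> in at_right (0::real). norm (\<epsilon> ^ k) \<le> norm (1::real)"
    using eventually_small[of 1, simplified] by eventually_elim (simp add: power_le_one)
  then show ?thesis by (rule moderate_bound[OF moderate_const])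
qed

lemma negligible_imp_moderate:
  assumes "negligible_net x" shows "moderate x"
proof -
  have "\<forall>\<^sub>F \<epsilon> in at_right 0. norm (x \<epsilon>) \<le> \<epsilon> ^ 0"
    using assms unfolding negligible_net_iff by blast
  then show ?thesis by (intro moderate_bound[OF moderate_const[of "1::real"]]) simp
qed

lemma represents_cong:
  assumes "represents u x" "negligible_net (\<lambda>\<epsilon>. v \<epsilon> - u \<epsilon>)"
  shows "represents v x"
proof -
  have "moderate (\<lambda>\<epsilon>. (v \<epsilon> - u \<epsilon>) + u \<epsilon>)"
    using assms(1) by (intro moderate_add negligible_imp_moderate[OF assms(2)]) (simp add: represents_def)
  then have "gen_rel v u" using assms by (simp add: gen_rel_def represents_def)
  then have "abs_gen v = abs_gen u" using Quotient_rel_abs[OF Quotient_gen] by blast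
  then show ?thesis using \<open>gen_rel v u\<close> assms(1) by (simp add: represents_def gen_rel_def)
qed

lemma represents_eqI:
  assumes "represents u x" "represents v y" "negligible_net (\<lambda>\<epsilon>. v \<epsilon> - u \<epsilon>)"
  shows "x = y"
  using represents_cong[OF assms(1,3)] assms(2) by (simp add: represents_def)

lemma represents_zero_iff: "represents u 0 \<longleftrightarrow> negligible_net u"
proof -
  have z: "represents (\<lambda>_. 0) 0"
    by (simp add: represents_def moderate_const zero_gen.abs_eq)
  show ?thesis using represents_unique[OF _ z, of u] represents_cong[OF z, of u] by auto
qed

lemma represents_gnorm: "represents \<xi> x \<Longrightarrow> represents (\<lambda>\<epsilon>. norm (\<xi> \<epsilon>)) (gnorm x)"
  using gnorm.abs_eq[of \<xi>] by (auto simp: represents_def gen_rel_refl elim: moderate_bound)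

lemma negligible_net_diff: "negligible_net x \<Longrightarrow> negligible_net y \<Longrightarrow> negligible_net (\<lambda>\<epsilon>. x \<epsilon> - y \<epsilon>)"
  using negligible_net_add[OF _ negligible_net_uminus] by fastforce

text \<open>The order only promises some pair of ordered representatives; passing to prescribed ones
  costs a negligible net, hence at most any given power of \<epsilon>.\<close>

lemma gle_imp_eventually:
  assumes "x \<le>\<^sub>g y" "represents u x" "represents v y"
  shows "\<forall>\<^sub>F \<epsilon> in at_right 0. u \<epsilon> \<le> v \<epsilon> + \<epsilon> ^ m"
proof -
  obtain u' v' where r: "represents u' x" "represents v' y"
    and le: "\<forall>\<^sub>F \<epsilon> in at_right 0. u' \<epsilon> \<le> v' \<epsilon>"
    using assms by (auto simp: gle_def)
  have "negligible_net (\<lambda>\<epsilon>. (u \<epsilon> - u' \<epsilon>) - (v \<epsilon> - v' \<epsilon>))"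
    by (rule negligible_net_diff) (rule represents_unique[OF assms(2) r(1)] represents_unique[OF assms(3) r(2)])+
  then have "\<forall>\<^sub>F \<epsilon> in at_right 0. norm ((u \<epsilon> - u' \<epsilon>) - (v \<epsilon> - v' \<epsilon>)) \<le> \<epsilon> ^ m"
    unfolding negligible_net_iff by blast
  then show ?thesis using le
    by eventually_elim (auto simp: abs_le_iff)
qed

lemma gle_antisym:
  assumes "x \<le>\<^sub>g y" "y \<le>\<^sub>g x" shows "x = y"
proof (rule represents_eqI[OF represents_rep represents_rep])
  show "negligible_net (\<lambda>\<epsilon>. rep_gen y \<epsilon> - rep_gen x \<epsilon>)"
    unfolding negligible_net_iff
  proof
    fix m
    show "\<forall>\<^sub>F \<epsilon> in at_right 0. norm (rep_gen y \<epsilon> - rep_gen x \<epsilon>) \<le> \<epsilon> ^ m"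
      using gle_imp_eventually[OF assms(1) represents_rep represents_rep, of m]
        gle_imp_eventually[OF assms(2) represents_rep represents_rep, of m]
      by eventually_elim (auto simp: abs_le_iff)
  qed
qed

lemma gmaximum_eqI:
  assumes "M \<in> S" "\<And>s. s \<in> S \<Longrightarrow> s \<le>\<^sub>g M"
  shows "gmaximum S = M"
  unfolding gmaximum_def by (rule the_equality) (use assms gle_antisym in blast)+

lemma gle_gMax:
  assumes "finite A" "a \<in> A"
  shows "g a \<le>\<^sub>g gMax A g"
proof -
  have "represents (\<lambda>\<epsilon>. Max ((\<lambda>i. rep_gen (g i) \<epsilon>) ` A)) (gMax A g)"
    using assms by (intro represents_gMax) auto
  moreover have "\<forall>\<^sub>F \<epsilon> in at_right 0. rep_gen (g a) \<epsilon> \<le> Max ((\<lambda>i. rep_gen (g i) \<epsilon>) ` A)"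
    using assms by (intro always_eventually allI Max_ge) auto
  ultimately show ?thesis unfolding gle_def using represents_rep by blast
qed

lemma gMax_gless:
  assumes "finite A" "A \<noteq> {}" "\<And>a. a \<in> A \<Longrightarrow> g a <\<^sub>g \<rho>"
  shows "gMax A g <\<^sub>g \<rho>"
proof -
  have "\<exists>q::nat. \<forall>\<^sub>F \<epsilon> in at_right 0. \<epsilon> ^ q \<le> rep_gen \<rho> \<epsilon> - rep_gen (g a) \<epsilon>" if "a \<in> A" for a
    using assms(3)[OF that] gless_iff[OF represents_rep represents_rep] by blast
  then obtain q :: "_ \<Rightarrow> nat"
    where q: "\<And>a. a \<in> A \<Longrightarrow> \<forall>\<^sub>F \<epsilon> in at_right 0. \<epsilon> ^ q a \<le> rep_gen \<rho> \<epsilon> - rep_gen (g a) \<epsilon>"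
    by metis
  have "\<forall>\<^sub>F \<epsilon> in at_right 0. \<forall>a\<in>A. \<epsilon> ^ q a \<le> rep_gen \<rho> \<epsilon> - rep_gen (g a) \<epsilon>"
    using q assms(1) by (simp add: eventually_ball_finite)
  \<comment> \<open>The index attaining the maximum may vary with \<epsilon>, so one exponent has to
    serve all of \<open>A\<close>; the sum dominates each of them.\<close>
  then have "\<forall>\<^sub>F \<epsilon> in at_right 0.
      \<epsilon> ^ (\<Sum>a\<in>A. q a) \<le> rep_gen \<rho> \<epsilon> - Max ((\<lambda>i. rep_gen (g i) \<epsilon>) ` A)"
    using eventually_small[of 1, simplified]
  proof eventually_elim
    case (elim \<epsilon>)
    have "Max ((\<lambda>i. rep_gen (g i) \<epsilon>) ` A) \<in> (\<lambda>i. rep_gen (g i) \<epsilon>) ` A"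
      using assms by (intro Max_in) auto
    then obtain a where a: "a \<in> A" "Max ((\<lambda>i. rep_gen (g i) \<epsilon>) ` A) = rep_gen (g a) \<epsilon>" by blast
    have "\<epsilon> ^ (\<Sum>a\<in>A. q a) \<le> \<epsilon> ^ q a"
      using elim a assms(1) by (intro power_decreasing member_le_sum) auto
    then show ?case using elim(1) a by fastforce
  qed
  then show ?thesis
    using gless_iff[OF represents_gMax[OF assms(1,2)] represents_rep] by blast
qed

section \<open>Sharply open sets in terms of nets\<close>

text \<open>The form in which openness applies to a perturbed representative, such as
  \<open>\<xi>\<close> shifted along a coordinate axis. The balls enter only as generators of the
  topology, hence the induction.\<close>

lemma sharp_open_net_nhds:
  fixes U :: "'a::real_normed_vector gen set"
  assumes "openin sharp_topology U" "x \<in> U" "represents \<xi> x"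
  obtains q :: nat
  where "\<And>\<eta>. \<forall>\<^sub>F \<epsilon> in at_right 0. norm (\<eta> \<epsilon> - \<xi> \<epsilon>) \<le> \<epsilon> ^ q \<Longrightarrow> moderate \<eta> \<and> abs_gen \<eta> \<in> U"
proof -
  have mod: "moderate \<eta>" if "\<forall>\<^sub>F \<epsilon> in at_right 0. norm (\<eta> \<epsilon> - \<xi> \<epsilon>) \<le> \<epsilon> ^ q"
    "represents \<xi> x" for \<eta> \<xi> :: "real \<Rightarrow> 'a" and x q
  proof -
    have "moderate (\<lambda>\<epsilon>. \<eta> \<epsilon> - \<xi> \<epsilon>)"
      using that(1) by (intro moderate_bound[OF moderate_power[of q]]) (erule eventually_mono, auto)
    then have "moderate (\<lambda>\<epsilon>. (\<eta> \<epsilon> - \<xi> \<epsilon>) + \<xi> \<epsilon>)"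
      using that(2) by (intro moderate_add) (auto simp: represents_def)
    then show ?thesis by simp
  qed
  have "generate_topology_on {gball x \<rho> |x \<rho>. 0 <\<^sub>g \<rho>} U"
    using assms(1) by (simp add: sharp_topology_def openin_topology_generated_by)
  then have "\<forall>x\<in>U. \<forall>\<xi>. represents \<xi> x \<longrightarrow>
    (\<exists>q. \<forall>\<eta>. (\<forall>\<^sub>F \<epsilon> in at_right 0. norm (\<eta> \<epsilon> - \<xi> \<epsilon>) \<le> \<epsilon> ^ q) \<longrightarrow> abs_gen \<eta> \<in> U)"
  proof induction
    case Empty
    then show ?case by simp
  next
    case (Int S T)
    show ?case
    proof (intro ballI allI impI)
      fix x \<xi> assume x: "x \<in> S \<inter> T" "represents \<xi> x"
      obtain p where p: "\<And>\<eta>. \<forall>\<^sub>F \<epsilon> in at_right 0. norm (\<eta> \<epsilon> - \<xi> \<epsilon>) \<le> \<epsilon> ^ p \<Longrightarrow> abs_gen \<eta> \<in> S"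
        using Int x by blast
      obtain q where q: "\<And>\<eta>. \<forall>\<^sub>F \<epsilon> in at_right 0. norm (\<eta> \<epsilon> - \<xi> \<epsilon>) \<le> \<epsilon> ^ q \<Longrightarrow> abs_gen \<eta> \<in> T"
        using Int x by blast
      have "abs_gen \<eta> \<in> S \<inter> T" if "\<forall>\<^sub>F \<epsilon> in at_right 0. norm (\<eta> \<epsilon> - \<xi> \<epsilon>) \<le> \<epsilon> ^ (p + q)" for \<eta>
      proof
        have *: "\<forall>\<^sub>F \<epsilon> in at_right 0. norm (\<eta> \<epsilon> - \<xi> \<epsilon>) \<le> \<epsilon> ^ r" if "r \<le> p + q" for r
          using \<open>\<forall>\<^sub>F \<epsilon> in at_right 0. norm (\<eta> \<epsilon> - \<xi> \<epsilon>) \<le> \<epsilon> ^ (p + q)\<close>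
            eventually_small[of 1, simplified]
          by eventually_elim (meson less_imp_le order_trans power_decreasing that)
        show "abs_gen \<eta> \<in> S" "abs_gen \<eta> \<in> T" using p q * by auto
      qed
      then show "\<exists>q. \<forall>\<eta>. (\<forall>\<^sub>F \<epsilon> in at_right 0. norm (\<eta> \<epsilon> - \<xi> \<epsilon>) \<le> \<epsilon> ^ q) \<longrightarrow> abs_gen \<eta> \<in> S \<inter> T"
        by blast
    qed
  next
    case (UN \<K>)
    then show ?case by (meson UnionE UnionI)
  next
    case (Basis S)
    then obtain z \<rho> where S: "S = gball z \<rho>" by blast
    show ?case
    proof (intro ballI allI impI)
      fix x \<xi> assume x: "x \<in> S" "represents \<xi> x"
      have "gnorm (x - z) <\<^sub>g \<rho>" using x by (simp add: S gball_def)
      moreover have "represents (\<lambda>\<epsilon>. norm (\<xi> \<epsilon> - rep_gen z \<epsilon>)) (gnorm (x - z))"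
        by (intro represents_gnorm represents_minus x represents_rep)
      ultimately obtain p :: nat
        where p: "\<forall>\<^sub>F \<epsilon> in at_right 0. \<epsilon> ^ p \<le> rep_gen \<rho> \<epsilon> - norm (\<xi> \<epsilon> - rep_gen z \<epsilon>)"
        using gless_iff[OF _ represents_rep] by blast
      \<comment> \<open>Since 2 \<epsilon>^(p+1) \<le> \<epsilon>^p for \<epsilon> < 1/2, the
        exponent \<open>Suc p\<close> works both as the size of the perturbation and as the gap that
        remains.\<close>
      have "abs_gen \<eta> \<in> S" if \<eta>: "\<forall>\<^sub>F \<epsilon> in at_right 0. norm (\<eta> \<epsilon> - \<xi> \<epsilon>) \<le> \<epsilon> ^ Suc p" for \<eta>
      proof -
        have "\<forall>\<^sub>F \<epsilon> in at_right 0. \<epsilon> ^ Suc p \<le> rep_gen \<rho> \<epsilon> - norm (\<eta> \<epsilon> - rep_gen z \<epsilon>)"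
          using p \<eta> eventually_small[of "1/2", simplified]
        proof eventually_elim
          case (elim \<epsilon>)
          have "(2 * \<epsilon>) * \<epsilon> ^ p \<le> 1 * \<epsilon> ^ p" using elim by (intro mult_right_mono) auto
          moreover have "norm (\<eta> \<epsilon> - rep_gen z \<epsilon>) \<le> norm (\<eta> \<epsilon> - \<xi> \<epsilon>) + norm (\<xi> \<epsilon> - rep_gen z \<epsilon>)"
            by (metis diff_add_cancel add_diff_eq norm_triangle_ineq)
          moreover have "\<epsilon> ^ Suc p = \<epsilon> * \<epsilon> ^ p" by simp
          ultimately show ?case using elim by linarith
        qed
        moreover have "represents (\<lambda>\<epsilon>. norm (\<eta> \<epsilon> - rep_gen z \<epsilon>)) (gnorm (abs_gen \<eta> - z))"
          by (intro represents_gnorm represents_minus represents_rep represents_abs_gen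
              mod[OF \<eta> x(2)])
        ultimately have "gnorm (abs_gen \<eta> - z) <\<^sub>g \<rho>" using gless_iff[OF _ represents_rep] by blast
        then show ?thesis by (simp add: S gball_def)
      qed
      then show "\<exists>q. \<forall>\<eta>. (\<forall>\<^sub>F \<epsilon> in at_right 0. norm (\<eta> \<epsilon> - \<xi> \<epsilon>) \<le> \<epsilon> ^ q) \<longrightarrow> abs_gen \<eta> \<in> S" by blast
    qed
  qed
  then obtain q where "\<And>\<eta>. \<forall>\<^sub>F \<epsilon> in at_right 0. norm (\<eta> \<epsilon> - \<xi> \<epsilon>) \<le> \<epsilon> ^ q \<Longrightarrow> abs_gen \<eta> \<in> U"
    using assms(2,3) by blast
  then show ?thesis using that mod[OF _ assms(3)] by blast
qed

section \<open>Calculus of iterated partial derivatives\<close>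

lemma pderiv_at_cong_open:
  fixes u v :: "real^'n \<Rightarrow> 'b::real_normed_vector"
  assumes "open \<Omega>" "x \<in> \<Omega>" "\<And>y. y \<in> \<Omega> \<Longrightarrow> u y = v y"
  shows "pderiv_at i u x = pderiv_at i v x"
    and "(\<lambda>t. u (x + t *\<^sub>R axis i 1)) differentiable (at 0) \<longleftrightarrow>
      (\<lambda>t. v (x + t *\<^sub>R axis i 1)) differentiable (at 0)"
proof -
  define T where "T = (\<lambda>t. x + t *\<^sub>R axis i 1) -` \<Omega>"
  have "open T" unfolding T_def by (intro open_vimage assms continuous_intros)
  moreover have "0 \<in> T" using assms by (simp add: T_def)
  ultimately have T: "\<forall>\<^sub>F t in nhds 0. u (x + t *\<^sub>R axis i 1) = v (x + t *\<^sub>R axis i 1)"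
    unfolding eventually_nhds using assms(3) by (intro exI[of _ T]) (simp add: T_def)
  show "pderiv_at i u x = pderiv_at i v x"
    unfolding pderiv_at_def
    by (rule vector_derivative_cong_eq) (use T in auto)
  have imp: "g differentiable (at 0)"
    if "f differentiable (at 0)" "\<And>t. t \<in> T \<Longrightarrow> f t = g t" for f g :: "real \<Rightarrow> 'b"
    using that has_derivative_transform_within_open[OF _ \<open>open T\<close> \<open>0 \<in> T\<close>]
    unfolding differentiable_def by metis
  show "(\<lambda>t. u (x + t *\<^sub>R axis i 1)) differentiable (at 0) \<longleftrightarrow>
      (\<lambda>t. v (x + t *\<^sub>R axis i 1)) differentiable (at 0)"
    by (rule iffI; erule imp) (auto simp: T_def assms(3))
qed

text \<open>The function d only has to agree with the difference on \<Omega>, since this is all that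
  one differentiation preserves: outside \<Omega> the values of \<open>pderiv_at\<close> carry no
  information. The induction needs this weak form.\<close>

lemma Ck_on_diff:
  assumes "open \<Omega>" "Ck_on k \<Omega> u" "Ck_on k \<Omega> v" "\<And>x. x \<in> \<Omega> \<Longrightarrow> d x = u x - v x"
  shows "Ck_on k \<Omega> d"
  using assms(2-4)
proof (induction k arbitrary: u v d)
  case 0
  then have "continuous_on \<Omega> (\<lambda>x. u x - v x)" by (auto intro: continuous_intros)
  then show ?case using 0 by (simp cong: continuous_on_cong)
next
  case (Suc k)
  have "continuous_on \<Omega> (\<lambda>x. u x - v x)" using Suc.prems by (auto intro: continuous_intros)
  then have c: "continuous_on \<Omega> d" using Suc.prems by (simp cong: continuous_on_cong)
  have diff: "(\<lambda>t. u (x + t *\<^sub>R axis i 1)) differentiable (at 0)"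
    "(\<lambda>t. v (x + t *\<^sub>R axis i 1)) differentiable (at 0)" if "x \<in> \<Omega>" for x i
    using that Suc.prems by auto
  have d: "(\<lambda>t. d (x + t *\<^sub>R axis i 1)) differentiable (at 0)" if "x \<in> \<Omega>" for x i
    using pderiv_at_cong_open(2)[where u = d and v = "\<lambda>x. u x - v x", OF assms(1) that Suc.prems(3), where i = i] diff[OF that, of i] by simp
  have eq: "pderiv_at i d x = pderiv_at i u x - pderiv_at i v x" if "x \<in> \<Omega>" for x i
    using pderiv_at_cong_open(1)[where u = d and v = "\<lambda>x. u x - v x", OF assms(1) that Suc.prems(3), where i = i] diff[OF that, of i]
    unfolding pderiv_at_def by (simp add: vector_derivative_diff_at)
  have "Ck_on k \<Omega> (pderiv_at i d)" for i
    by (rule Suc.IH[of "pderiv_at i u" "pderiv_at i v"]) (use Suc.prems eq in auto)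
  then show ?case using c d by simp
qed

lemma smooth_on_diff:
  assumes "open \<Omega>" "smooth_on \<Omega> u" "smooth_on \<Omega> v"
  shows "smooth_on \<Omega> (\<lambda>x. u x - v x)"
  unfolding smooth_on_def
proof
  show "Ck_on k \<Omega> (\<lambda>x. u x - v x)" for k
    by (rule Ck_on_diff[of \<Omega> k u v]) (use assms in \<open>auto simp: smooth_on_def\<close>)
qed

lemma smooth_on_pderiv_at: "smooth_on \<Omega> u \<Longrightarrow> smooth_on \<Omega> (pderiv_at i u)"
  unfolding smooth_on_def using Ck_on.simps(2) by blast

lemma smooth_on_funpow_pderiv_at: "smooth_on \<Omega> u \<Longrightarrow> smooth_on \<Omega> ((pderiv_at i ^^ k) u)"
  by (induction k) (auto intro: smooth_on_pderiv_at)

lemma smooth_on_foldr_pderiv_at: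
  "smooth_on \<Omega> u \<Longrightarrow> smooth_on \<Omega> (foldr (\<lambda>i. pderiv_at i ^^ \<alpha> i) cs u)"
  by (induction cs) (auto intro: smooth_on_funpow_pderiv_at)

lemma smooth_on_mpderiv: "smooth_on \<Omega> u \<Longrightarrow> smooth_on \<Omega> (mpderiv \<alpha> u)"
  unfolding mpderiv_def by (rule smooth_on_foldr_pderiv_at)

lemma smooth_on_imp_continuous_on: "smooth_on \<Omega> u \<Longrightarrow> continuous_on \<Omega> u"
  unfolding smooth_on_def using Ck_on.simps(1) by blast

lemma smooth_on_imp_differentiable:
  "smooth_on \<Omega> u \<Longrightarrow> x \<in> \<Omega> \<Longrightarrow> (\<lambda>t. u (x + t *\<^sub>R axis i 1)) differentiable (at 0)"
  unfolding smooth_on_def using Ck_on.simps(2) by blast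

lemma Ck_on_subset: "Ck_on k \<Omega> u \<Longrightarrow> \<Omega>' \<subseteq> \<Omega> \<Longrightarrow> Ck_on k \<Omega>' u"
  by (induction k arbitrary: u) (auto intro: continuous_on_subset)

lemma smooth_on_subset: "smooth_on \<Omega> u \<Longrightarrow> \<Omega>' \<subseteq> \<Omega> \<Longrightarrow> smooth_on \<Omega>' u"
  unfolding smooth_on_def using Ck_on_subset by blast

lemma pderiv_at_diff:
  assumes "open \<Omega>" "smooth_on \<Omega> u" "smooth_on \<Omega> v" "\<And>y. y \<in> \<Omega> \<Longrightarrow> d y = u y - v y" "x \<in> \<Omega>"
  shows "pderiv_at i d x = pderiv_at i u x - pderiv_at i v x"
  using pderiv_at_cong_open(1)[where u = d and v = "\<lambda>x. u x - v x", OF assms(1,5,4), where i = i]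
    smooth_on_imp_differentiable[OF assms(2,5), of i] smooth_on_imp_differentiable[OF assms(3,5), of i]
  unfolding pderiv_at_def by (simp add: vector_derivative_diff_at)

lemma mpderiv_diff:
  assumes "open \<Omega>" "smooth_on \<Omega> u" "smooth_on \<Omega> v" "x \<in> \<Omega>"
  shows "mpderiv \<alpha> (\<lambda>y. u y - v y) x = mpderiv \<alpha> u x - mpderiv \<alpha> v x"
proof -
  have pow: "\<forall>x\<in>\<Omega>. (pderiv_at i ^^ k) d x = (pderiv_at i ^^ k) u x - (pderiv_at i ^^ k) v x"
    if "smooth_on \<Omega> u" "smooth_on \<Omega> v" "\<forall>y\<in>\<Omega>. d y = u y - v y" for i k u v d
  proof (induction k)
    case (Suc k)
    then show ?case
      using pderiv_at_diff[OF assms(1) smooth_on_funpow_pderiv_at[OF that(1)]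
          smooth_on_funpow_pderiv_at[OF that(2)]] by simp
  qed (use that in auto)
  have "\<forall>x\<in>\<Omega>. foldr (\<lambda>i. pderiv_at i ^^ \<alpha> i) cs (\<lambda>y. u y - v y) x =
      foldr (\<lambda>i. pderiv_at i ^^ \<alpha> i) cs u x - foldr (\<lambda>i. pderiv_at i ^^ \<alpha> i) cs v x" for cs
  proof (induction cs)
    case (Cons i cs)
    then show ?case
      using pow[OF smooth_on_foldr_pderiv_at[OF assms(2)] smooth_on_foldr_pderiv_at[OF assms(3)]]
      by simp
  qed simp
  then show ?thesis using assms(4) by (simp add: mpderiv_def)
qed

lemma pderiv_at_translate: "pderiv_at i (\<lambda>y. u (y + \<delta>)) = (\<lambda>y. pderiv_at i u (y + \<delta>))"
  by (rule ext) (simp add: pderiv_at_def algebra_simps)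

lemma mpderiv_translate: "mpderiv \<alpha> (\<lambda>y. u (y + \<delta>)) = (\<lambda>y. mpderiv \<alpha> u (y + \<delta>))"
proof -
  have pow: "(pderiv_at i ^^ k) (\<lambda>y. u (y + \<delta>)) = (\<lambda>y. (pderiv_at i ^^ k) u (y + \<delta>))" for i k u
    by (induction k) (auto simp: pderiv_at_translate)
  have "foldr (\<lambda>i. pderiv_at i ^^ \<alpha> i) cs (\<lambda>y. u (y + \<delta>)) =
      (\<lambda>y. foldr (\<lambda>i. pderiv_at i ^^ \<alpha> i) cs u (y + \<delta>))" for cs
    by (induction cs) (auto simp: pow)
  then show ?thesis by (simp add: mpderiv_def)
qed

lemma smooth_on_translate:
  assumes "smooth_on \<Omega> u" shows "smooth_on {y. y + \<delta> \<in> \<Omega>} (\<lambda>y. u (y + \<delta>))"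
proof -
  have "Ck_on k {y. y + \<delta> \<in> \<Omega>} (\<lambda>y. u (y + \<delta>))" if "Ck_on k \<Omega> u" for k
    using that
  proof (induction k arbitrary: u)
    case 0
    have "continuous_on {y. y + \<delta> \<in> \<Omega>} (u \<circ> (\<lambda>y. y + \<delta>))"
      by (rule continuous_on_compose)
        (use 0 in \<open>auto intro!: continuous_intros elim: continuous_on_subset\<close>)
    then show ?case by (simp add: o_def)
  next
    case (Suc k)
    have "continuous_on {y. y + \<delta> \<in> \<Omega>} (u \<circ> (\<lambda>y. y + \<delta>))"
      by (rule continuous_on_compose)
        (use Suc.prems in \<open>auto intro!: continuous_intros elim: continuous_on_subset\<close>)
    moreover have "(\<lambda>t. u (x + t *\<^sub>R axis i 1 + \<delta>)) differentiable at 0" if "x + \<delta> \<in> \<Omega>" for x i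
    proof -
      have "(\<lambda>t. u ((x + \<delta>) + t *\<^sub>R axis i 1)) differentiable at 0" using Suc.prems that by simp
      then show ?thesis by (simp add: algebra_simps)
    qed
    moreover have "Ck_on k {y. y + \<delta> \<in> \<Omega>} (pderiv_at i (\<lambda>y. u (y + \<delta>)))" for i
      unfolding pderiv_at_translate by (rule Suc.IH) (use Suc.prems in auto)
    ultimately show ?case by (simp add: o_def)
  qed
  then show ?thesis using assms by (simp add: smooth_on_def)
qed

section \<open>Negligible values force negligible derivatives\<close>

lemma smooth_on_has_real_derivative:
  fixes u :: "real^'n \<Rightarrow> real"
  assumes "smooth_on \<Omega> u" "x + t *\<^sub>R axis i 1 \<in> \<Omega>"
  shows "((\<lambda>s. u (x + s *\<^sub>R axis i 1)) has_real_derivative pderiv_at i u (x + t *\<^sub>R axis i 1)) (at t)"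
proof -
  have "(\<lambda>s. u ((x + t *\<^sub>R axis i 1) + s *\<^sub>R axis i 1)) differentiable (at 0)"
    by (rule smooth_on_imp_differentiable[OF assms])
  then have "((\<lambda>s. u ((x + t *\<^sub>R axis i 1) + s *\<^sub>R axis i 1)) has_real_derivative
      pderiv_at i u (x + t *\<^sub>R axis i 1)) (at 0)"
    unfolding pderiv_at_def has_real_derivative_iff_has_vector_derivative
    using vector_derivative_works by blast
  then have "((\<lambda>s. u (x + (s + t) *\<^sub>R axis i 1)) has_real_derivative
      pderiv_at i u (x + t *\<^sub>R axis i 1)) (at 0)"
    by (simp add: algebra_simps)
  then show ?thesis
    using DERIV_shift[of "\<lambda>s. u (x + s *\<^sub>R axis i 1)" _ 0 t] by simp
qed

text \<open>Landau-type interpolation: the mean value theorem on [0, h] yields a point s where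
  \<phi>' is the difference quotient; applied to \<phi>' on [0, s], it bounds the way back to 0 by B
  h.\<close>

lemma deriv_interpolation:
  fixes \<phi> :: "real \<Rightarrow> real"
  assumes "0 < h"
    and "\<And>t. 0 \<le> t \<Longrightarrow> t \<le> h \<Longrightarrow> (\<phi> has_real_derivative \<phi>' t) (at t)"
    and "\<And>t. 0 \<le> t \<Longrightarrow> t \<le> h \<Longrightarrow> (\<phi>' has_real_derivative \<phi>'' t) (at t)"
    and "\<And>t. 0 \<le> t \<Longrightarrow> t \<le> h \<Longrightarrow> \<bar>\<phi>'' t\<bar> \<le> B"
  shows "\<bar>\<phi>' 0\<bar> \<le> (\<bar>\<phi> h\<bar> + \<bar>\<phi> 0\<bar>) / h + B * h"
proof -
  obtain s where s: "0 < s" "s < h" "\<phi> h - \<phi> 0 = (h - 0) * \<phi>' s"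
    using MVT2[of 0 h \<phi> \<phi>'] assms by auto
  obtain t where t: "0 < t" "t < s" "\<phi>' s - \<phi>' 0 = (s - 0) * \<phi>'' t"
    using MVT2[of 0 s \<phi>' \<phi>''] assms s by auto
  have "\<bar>s * \<phi>'' t\<bar> \<le> h * B"
    unfolding abs_mult using s t assms(4)[of t] by (intro mult_mono) auto
  moreover have "\<phi>' s = (\<phi> h - \<phi> 0) / h" using s assms(1) by simp
  then have "\<bar>\<phi>' s\<bar> \<le> (\<bar>\<phi> h\<bar> + \<bar>\<phi> 0\<bar>) / h"
    using assms(1) by (simp add: divide_right_mono)
  moreover have "\<phi>' 0 = \<phi>' s - s * \<phi>'' t" using t by simp
  ultimately show ?thesis by (simp add: mult.commute)
qed

text \<open>\<open>deriv_interpolation\<close> along the i-th axis. Only derivatives in the single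
  direction i occur, which is what makes the lemma usable under a fixed order of the
  coordinates.\<close>

lemma negligible_pderiv_at:
  fixes U :: "(real^'n) gen set" and v :: "real \<Rightarrow> real^'n \<Rightarrow> real"
  assumes U: "openin sharp_topology U" "U \<subseteq> strongly_internal_set \<Omega>"
    and smooth: "\<And>\<epsilon>. \<epsilon> \<in> {0<..1} \<Longrightarrow> smooth_on (\<Omega> \<epsilon>) (v \<epsilon>)"
    and negl: "\<And>x \<xi>. x \<in> U \<Longrightarrow> represents \<xi> x \<Longrightarrow> negligible_net (\<lambda>\<epsilon>. v \<epsilon> (\<xi> \<epsilon>))"
    and mod: "\<And>x \<xi>. x \<in> U \<Longrightarrow> represents \<xi> x \<Longrightarrow>
      moderate (\<lambda>\<epsilon>. pderiv_at i (pderiv_at i (v \<epsilon>)) (\<xi> \<epsilon>))"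
    and x: "x \<in> U" "represents \<xi> x"
  shows "negligible_net (\<lambda>\<epsilon>. pderiv_at i (v \<epsilon>) (\<xi> \<epsilon>))"
proof -
  obtain q where q: "\<And>\<eta>. \<forall>\<^sub>F \<epsilon> in at_right 0. norm (\<eta> \<epsilon> - \<xi> \<epsilon>) \<le> \<epsilon> ^ q \<Longrightarrow>
      moderate \<eta> \<and> abs_gen \<eta> \<in> U"
    using sharp_open_net_nhds[OF U(1) x] by blast
  \<comment> \<open>Moderateness and membership in the domain are known net by net, but are needed
    on the whole segment. The constraint given to \<open>nets_uniform\<close> is a fixed ball; only
    the exponent N grows.\<close>
  define G where "G N \<epsilon> y \<longleftrightarrow> y \<in> \<Omega> \<epsilon> \<and> norm (pderiv_at i (pderiv_at i (v \<epsilon>)) y) \<le> inverse \<epsilon> ^ N"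
    for N :: nat and \<epsilon> y
  have "\<exists>N. \<forall>\<^sub>F \<epsilon> in at_right 0. \<forall>y. norm (y - \<xi> \<epsilon>) \<le> \<epsilon> ^ q \<longrightarrow> G N \<epsilon> y"
  proof (rule nets_uniform)
    show "G r \<epsilon> y" if "p \<le> r" "0 < \<epsilon>" "\<epsilon> < 1" "G p \<epsilon> y" for p r \<epsilon> y
      using that power_increasing[of p r "inverse \<epsilon>"]
      by (auto simp: G_def one_le_inverse_iff)
    show "\<forall>\<^sub>F \<epsilon> in at_right 0. norm (\<xi> \<epsilon> - \<xi> \<epsilon>) \<le> \<epsilon> ^ q" for p :: nat
      using eventually_small[of 1, simplified] by eventually_elim simp
    show "\<exists>N. \<forall>\<^sub>F \<epsilon> in at_right 0. G N \<epsilon> (\<eta> \<epsilon>)"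
      if \<eta>: "\<And>p::nat. \<forall>\<^sub>F \<epsilon> in at_right 0. norm (\<eta> \<epsilon> - \<xi> \<epsilon>) \<le> \<epsilon> ^ q" for \<eta>
    proof -
      have y: "abs_gen \<eta> \<in> U" "represents \<eta> (abs_gen \<eta>)"
        using q[OF \<eta>] by (auto simp: represents_def)
      obtain N :: nat
        where "\<forall>\<^sub>F \<epsilon> in at_right 0. norm (pderiv_at i (pderiv_at i (v \<epsilon>)) (\<eta> \<epsilon>)) \<le> inverse \<epsilon> ^ N"
        using mod[OF y] unfolding moderate_iff by blast
      moreover have "\<forall>\<^sub>F \<epsilon> in at_right 0. \<eta> \<epsilon> \<in> \<Omega> \<epsilon>"
        using U(2) y by (auto simp: strongly_internal_set_def)
      ultimately have "\<forall>\<^sub>F \<epsilon> in at_right 0. G N \<epsilon> (\<eta> \<epsilon>)"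
        by eventually_elim (simp add: G_def)
      then show ?thesis by blast
    qed
  qed
  then obtain N where N: "\<forall>\<^sub>F \<epsilon> in at_right 0. \<forall>y. norm (y - \<xi> \<epsilon>) \<le> \<epsilon> ^ q \<longrightarrow> G N \<epsilon> y" by blast
  show ?thesis
    unfolding negligible_net_iff
  proof
    fix m
    \<comment> \<open>The summand q keeps the segment in the ball, and N cancels the bound
      \<epsilon>^(-N), leaving \<epsilon>^(q+m+1). In the bound
      \<open>\<epsilon> ^ (p + m + 2)\<close> on the values, p is used up by the division by the
      step.\<close>
    define p where "p = q + N + m + 1"
    define \<eta> where "\<eta> \<epsilon> = \<xi> \<epsilon> + (\<epsilon> ^ p) *\<^sub>R axis i 1" for \<epsilon>
    have "\<forall>\<^sub>F \<epsilon> in at_right 0. norm (\<eta> \<epsilon> - \<xi> \<epsilon>) \<le> \<epsilon> ^ q"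
      using eventually_small[of 1, simplified]
      by eventually_elim (auto simp: \<eta>_def intro!: power_decreasing simp: p_def simp del: power_Suc)
    then have y: "abs_gen \<eta> \<in> U" "represents \<eta> (abs_gen \<eta>)"
      using q by (auto simp: represents_def)
    have "\<forall>\<^sub>F \<epsilon> in at_right 0. norm (v \<epsilon> (\<xi> \<epsilon>)) \<le> \<epsilon> ^ (p + m + 2)"
      "\<forall>\<^sub>F \<epsilon> in at_right 0. norm (v \<epsilon> (\<eta> \<epsilon>)) \<le> \<epsilon> ^ (p + m + 2)"
      using negl[OF x] negl[OF y] unfolding negligible_net_iff by blast+
    then show "\<forall>\<^sub>F \<epsilon> in at_right 0. norm (pderiv_at i (v \<epsilon>) (\<xi> \<epsilon>)) \<le> \<epsilon> ^ m"
      using N eventually_small[of "1/4", simplified]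
    proof eventually_elim
      case (elim \<epsilon>)
      have e: "0 < \<epsilon>" "\<epsilon> < 1/4" using elim by auto
      define h where "h = \<epsilon> ^ p"
      have h: "0 < h" "h \<le> \<epsilon> ^ q"
        using e by (auto simp: h_def p_def intro!: power_decreasing simp del: power_Suc)
      define \<gamma> where "\<gamma> t = \<xi> \<epsilon> + t *\<^sub>R axis i 1" for t
      have G: "G N \<epsilon> (\<gamma> t)" if "0 \<le> t" "t \<le> h" for t
        using elim(3) that h by (auto simp: \<gamma>_def)
      have sm: "smooth_on (\<Omega> \<epsilon>) (v \<epsilon>)" using smooth e by auto
      have "\<bar>pderiv_at i (v \<epsilon>) (\<gamma> 0)\<bar> \<le>
          (\<bar>v \<epsilon> (\<gamma> h)\<bar> + \<bar>v \<epsilon> (\<gamma> 0)\<bar>) / h + inverse \<epsilon> ^ N * h"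
      proof (rule deriv_interpolation[OF h(1), where \<phi> = "\<lambda>t. v \<epsilon> (\<gamma> t)"
            and \<phi>' = "\<lambda>t. pderiv_at i (v \<epsilon>) (\<gamma> t)"
            and \<phi>'' = "\<lambda>t. pderiv_at i (pderiv_at i (v \<epsilon>)) (\<gamma> t)"])
        fix t assume "0 \<le> t" "t \<le> h"
        then have "G N \<epsilon> (\<gamma> t)" by (rule G)
        then show "((\<lambda>t. v \<epsilon> (\<gamma> t)) has_real_derivative pderiv_at i (v \<epsilon>) (\<gamma> t)) (at t)"
          "((\<lambda>t. pderiv_at i (v \<epsilon>) (\<gamma> t)) has_real_derivative
            pderiv_at i (pderiv_at i (v \<epsilon>)) (\<gamma> t)) (at t)"
          "\<bar>pderiv_at i (pderiv_at i (v \<epsilon>)) (\<gamma> t)\<bar> \<le> inverse \<epsilon> ^ N"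
          using smooth_on_has_real_derivative[OF sm]
            smooth_on_has_real_derivative[OF smooth_on_pderiv_at[OF sm]]
          by (auto simp: G_def \<gamma>_def)
      qed
      also have "\<dots> \<le> (\<epsilon> ^ (p + m + 2) + \<epsilon> ^ (p + m + 2)) / h + inverse \<epsilon> ^ N * h"
        using elim h by (intro add_mono divide_right_mono) (auto simp: \<gamma>_def \<eta>_def h_def)
      also have "\<dots> = 2 * \<epsilon> ^ (m + 2) + \<epsilon> ^ (q + m + 1)"
        using e by (simp add: h_def p_def power_add field_simps)
      also have "\<dots> \<le> 2 * \<epsilon> ^ (m + 1) + \<epsilon> ^ (m + 1)"
        using e by (intro add_mono mult_left_mono power_decreasing) auto
      also have "\<dots> = (3 * \<epsilon>) * \<epsilon> ^ m" by simp
      also have "\<dots> \<le> 1 * \<epsilon> ^ m" using e by (intro mult_right_mono) auto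
      finally show ?case by (simp add: \<gamma>_def)
    qed
  qed
qed

lemma distinct_coords: "distinct (coords :: 'n::finite list)"
  unfolding coords_def by (rule someI2_ex) (use finite_distinct_list[OF finite] in blast)+

text \<open>\<open>foldr\<close> differentiates along the end of the list first. An iterated
  derivative stopped halfway is therefore again an \<open>mpderiv\<close>, with exponent 0 at the
  coordinates still to come, so that hypotheses on \<open>mpderiv\<close> apply to it.\<close>

lemma foldr_funpow_pderiv_at_eq_mpderiv:
  fixes i :: "'n::finite" and u :: "real^'n \<Rightarrow> 'b::real_normed_vector"
  assumes "coords = pre @ i # cs"
  shows "(pderiv_at i ^^ a) (foldr (\<lambda>j. pderiv_at j ^^ \<alpha> j) cs u) =
    mpderiv (\<lambda>j. if j = i then a else if j \<in> set cs then \<alpha> j else 0) u"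
proof -
  let ?\<beta> = "\<lambda>j. if j = i then a else if j \<in> set cs then \<alpha> j else 0"
  have d: "i \<notin> set cs" "\<And>j. j \<in> set pre \<Longrightarrow> ?\<beta> j = 0"
    using distinct_coords[where 'n = 'n] unfolding assms by auto
  have pre: "foldr (\<lambda>j. pderiv_at j ^^ \<beta> j) xs w = w"
    if "\<And>j. j \<in> set xs \<Longrightarrow> \<beta> j = 0" for \<beta> xs and w :: "real^'n \<Rightarrow> 'b"
    using that by (induction xs) auto
  have cs: "foldr (\<lambda>j. pderiv_at j ^^ ?\<beta> j) cs u = foldr (\<lambda>j. pderiv_at j ^^ \<alpha> j) cs u"
    by (rule foldr_cong) (use d in auto)
  have "mpderiv ?\<beta> u = foldr (\<lambda>j. pderiv_at j ^^ ?\<beta> j) (i # cs) u"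
    unfolding mpderiv_def assms foldr_append using d(2) by (rule pre)
  then show ?thesis using cs by simp
qed

text \<open>
  Only derivatives in the order of \<^const>\<open>coords\<close> are known to be moderate. Working up along that
  order, both the derivative to be estimated and the second derivative used in the interpolation are
  of this form, so that no symmetry of second derivatives is needed.
\<close>

lemma negligible_mpderiv:
  fixes U :: "(real^'n) gen set" and w :: "real \<Rightarrow> real^'n \<Rightarrow> real"
  assumes U: "openin sharp_topology U" "U \<subseteq> strongly_internal_set \<Omega>"
    and smooth: "\<And>\<epsilon>. \<epsilon> \<in> {0<..1} \<Longrightarrow> smooth_on (\<Omega> \<epsilon>) (w \<epsilon>)"
    and negl: "\<And>x \<xi>. x \<in> U \<Longrightarrow> represents \<xi> x \<Longrightarrow> negligible_net (\<lambda>\<epsilon>. w \<epsilon> (\<xi> \<epsilon>))"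
    and mod: "\<And>x \<xi> \<alpha>. x \<in> U \<Longrightarrow> represents \<xi> x \<Longrightarrow>
      moderate (\<lambda>\<epsilon>. mpderiv \<alpha> (w \<epsilon>) (\<xi> \<epsilon>))"
    and x: "x \<in> U" "represents \<xi> x"
  shows "negligible_net (\<lambda>\<epsilon>. mpderiv \<alpha> (w \<epsilon>) (\<xi> \<epsilon>))"
proof -
  \<comment> \<open>Claimed for all points of \<open>U\<close> at once, because the interpolation
    evaluates the lower derivative at shifted points as well.\<close>
  have "\<forall>x \<xi>. x \<in> U \<longrightarrow> represents \<xi> x \<longrightarrow>
      negligible_net (\<lambda>\<epsilon>. foldr (\<lambda>j. pderiv_at j ^^ \<alpha> j) cs (w \<epsilon>) (\<xi> \<epsilon>))"
    if "coords = pre @ cs" for pre cs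
    using that
  proof (induction cs arbitrary: pre)
    case Nil
    then show ?case using negl by simp
  next
    case (Cons i cs)
    define v where "v \<epsilon> = foldr (\<lambda>j. pderiv_at j ^^ \<alpha> j) cs (w \<epsilon>)" for \<epsilon>
    have v: "\<forall>x \<xi>. x \<in> U \<longrightarrow> represents \<xi> x \<longrightarrow> negligible_net (\<lambda>\<epsilon>. v \<epsilon> (\<xi> \<epsilon>))"
      unfolding v_def using Cons.IH[of "pre @ [i]"] Cons.prems by simp
    have eq: "(pderiv_at i ^^ a) (v \<epsilon>) =
        mpderiv (\<lambda>j. if j = i then a else if j \<in> set cs then \<alpha> j else 0) (w \<epsilon>)" for a \<epsilon>
      unfolding v_def by (rule foldr_funpow_pderiv_at_eq_mpderiv[OF Cons.prems])
    have "\<forall>x \<xi>. x \<in> U \<longrightarrow> represents \<xi> x \<longrightarrow>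
        negligible_net (\<lambda>\<epsilon>. (pderiv_at i ^^ a) (v \<epsilon>) (\<xi> \<epsilon>))" for a
    proof (induction a)
      case 0
      then show ?case using v by simp
    next
      case (Suc a)
      have "negligible_net (\<lambda>\<epsilon>. pderiv_at i ((pderiv_at i ^^ a) (v \<epsilon>)) (\<xi> \<epsilon>))"
        if x: "x \<in> U" "represents \<xi> x" for x \<xi>
      proof (rule negligible_pderiv_at[OF U _ _ _ x])
        show "smooth_on (\<Omega> \<epsilon>) ((pderiv_at i ^^ a) (v \<epsilon>))" if "\<epsilon> \<in> {0<..1}" for \<epsilon>
          unfolding v_def
          by (intro smooth_on_funpow_pderiv_at smooth_on_foldr_pderiv_at smooth that)
        show "moderate (\<lambda>\<epsilon>. pderiv_at i (pderiv_at i ((pderiv_at i ^^ a) (v \<epsilon>))) (\<eta> \<epsilon>))"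
          if y: "y \<in> U" "represents \<eta> y" for y \<eta>
        proof -
          have "pderiv_at i (pderiv_at i ((pderiv_at i ^^ a) (v \<epsilon>))) =
              (pderiv_at i ^^ Suc (Suc a)) (v \<epsilon>)" for \<epsilon> by simp
          then show ?thesis unfolding eq using mod[OF y] by simp
        qed
      qed (use Suc in blast)
      then show ?case by simp
    qed
    then show ?case by (simp add: v_def)
  qed
  from this[of "[]" coords] show ?thesis using x by (simp add: mpderiv_def)
qed

section \<open>Defining nets and well-definedness of derivatives\<close>

lemma defines_gsf_moderate_mpderiv:
  "defines_gsf \<Omega> u U f \<Longrightarrow> x \<in> U \<Longrightarrow> represents \<xi> x \<Longrightarrow> moderate (\<lambda>\<epsilon>. mpderiv \<alpha> (u \<epsilon>) (\<xi> \<epsilon>))"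
  by (simp add: defines_gsf_def)

lemma defines_gsf_represents:
  "defines_gsf \<Omega> u U f \<Longrightarrow> x \<in> U \<Longrightarrow> represents \<xi> x \<Longrightarrow> represents (\<lambda>\<epsilon>. u \<epsilon> (\<xi> \<epsilon>)) (f x)"
  by (simp add: defines_gsf_def)

lemma defines_gsf_smooth:
  "defines_gsf \<Omega> u U f \<Longrightarrow> \<epsilon> \<in> {0<..1} \<Longrightarrow> open (\<Omega> \<epsilon>) \<and> smooth_on (\<Omega> \<epsilon>) (u \<epsilon>)"
  by (simp add: defines_gsf_def)

lemma defines_gsf_diff:
  assumes f: "defines_gsf \<Omega> u U f" and g: "defines_gsf \<Omega>' v U g"
  shows "defines_gsf (\<lambda>\<epsilon>. \<Omega> \<epsilon> \<inter> \<Omega>' \<epsilon>) (\<lambda>\<epsilon> y. u \<epsilon> y - v \<epsilon> y) U (\<lambda>x. f x - g x)"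
  unfolding defines_gsf_def
proof (intro conjI ballI allI impI)
  fix \<epsilon> :: real assume \<epsilon>: "\<epsilon> \<in> {0<..1}"
  note s = defines_gsf_smooth[OF f \<epsilon>] defines_gsf_smooth[OF g \<epsilon>]
  then show "open (\<Omega> \<epsilon> \<inter> \<Omega>' \<epsilon>)" by blast
  then show "smooth_on (\<Omega> \<epsilon> \<inter> \<Omega>' \<epsilon>) (\<lambda>y. u \<epsilon> y - v \<epsilon> y)"
    using s by (intro smooth_on_diff) (auto intro: smooth_on_subset)
next
  have in\<Omega>: "\<forall>\<^sub>F \<epsilon> in at_right 0. \<xi> \<epsilon> \<in> \<Omega> \<epsilon> \<inter> \<Omega>' \<epsilon>" if "x \<in> U" "represents \<xi> x" for x \<xi>
    using f g that unfolding defines_gsf_def strongly_internal_set_def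
    by (simp add: eventually_conj_iff subset_iff)
  then show "U \<subseteq> strongly_internal_set (\<lambda>\<epsilon>. \<Omega> \<epsilon> \<inter> \<Omega>' \<epsilon>)"
    by (auto simp: strongly_internal_set_def)
  fix x \<xi> assume x: "x \<in> U" "represents \<xi> x"
  show "represents (\<lambda>\<epsilon>. u \<epsilon> (\<xi> \<epsilon>) - v \<epsilon> (\<xi> \<epsilon>)) (f x - g x)"
    by (intro represents_minus defines_gsf_represents[OF f x] defines_gsf_represents[OF g x])
  fix \<alpha>
  have "moderate (\<lambda>\<epsilon>. mpderiv \<alpha> (u \<epsilon>) (\<xi> \<epsilon>) - mpderiv \<alpha> (v \<epsilon>) (\<xi> \<epsilon>))"
    by (intro moderate_diff defines_gsf_moderate_mpderiv[OF f x] defines_gsf_moderate_mpderiv[OF g x])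
  then show "moderate (\<lambda>\<epsilon>. mpderiv \<alpha> (\<lambda>y. u \<epsilon> y - v \<epsilon> y) (\<xi> \<epsilon>))"
  proof (rule moderate_bound)
    show "\<forall>\<^sub>F \<epsilon> in at_right 0. norm (mpderiv \<alpha> (\<lambda>y. u \<epsilon> y - v \<epsilon> y) (\<xi> \<epsilon>)) \<le>
        norm (mpderiv \<alpha> (u \<epsilon>) (\<xi> \<epsilon>) - mpderiv \<alpha> (v \<epsilon>) (\<xi> \<epsilon>))"
      using in\<Omega>[OF x] eventually_small[of 1, simplified]
    proof eventually_elim
      case (elim \<epsilon>)
      then have \<epsilon>: "\<epsilon> \<in> {0<..1}" by simp
      note s = defines_gsf_smooth[OF f \<epsilon>] defines_gsf_smooth[OF g \<epsilon>]
      have "mpderiv \<alpha> (\<lambda>y. u \<epsilon> y - v \<epsilon> y) (\<xi> \<epsilon>) =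
          mpderiv \<alpha> (u \<epsilon>) (\<xi> \<epsilon>) - mpderiv \<alpha> (v \<epsilon>) (\<xi> \<epsilon>)"
        using s by (intro mpderiv_diff[OF _ _ _ elim(1)]) (auto intro: smooth_on_subset)
      then show ?case by simp
    qed
  qed
qed

text \<open>A negligible shift turns a representative of x into another one, and the conditions on a
  defining net range over all representatives.\<close>

lemma defines_gsf_translate:
  assumes f: "defines_gsf \<Omega> u U f" and "negligible_net \<delta>"
  shows "defines_gsf (\<lambda>\<epsilon>. {y. y + \<delta> \<epsilon> \<in> \<Omega> \<epsilon>}) (\<lambda>\<epsilon> y. u \<epsilon> (y + \<delta> \<epsilon>)) U f"
  unfolding defines_gsf_def
proof (intro conjI ballI allI impI)
  fix \<epsilon> :: real assume \<epsilon>: "\<epsilon> \<in> {0<..1}"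
  have "open ((\<lambda>y. y + \<delta> \<epsilon>) -` \<Omega> \<epsilon>)"
    using defines_gsf_smooth[OF f \<epsilon>] by (intro open_vimage continuous_intros) auto
  then show "open {y. y + \<delta> \<epsilon> \<in> \<Omega> \<epsilon>}" by (simp add: vimage_def)
  show "smooth_on {y. y + \<delta> \<epsilon> \<in> \<Omega> \<epsilon>} (\<lambda>y. u \<epsilon> (y + \<delta> \<epsilon>))"
    using defines_gsf_smooth[OF f \<epsilon>] by (intro smooth_on_translate) auto
next
  have r: "represents (\<lambda>\<epsilon>. \<xi> \<epsilon> + \<delta> \<epsilon>) x" if "represents \<xi> x" for \<xi> x
    by (rule represents_cong[OF that]) (simp add: assms)
  show "U \<subseteq> strongly_internal_set (\<lambda>\<epsilon>. {y. y + \<delta> \<epsilon> \<in> \<Omega> \<epsilon>})"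
    using f r by (auto simp: strongly_internal_set_def defines_gsf_def)
  fix x \<xi> assume x: "x \<in> U" "represents \<xi> x"
  show "represents (\<lambda>\<epsilon>. u \<epsilon> (\<xi> \<epsilon> + \<delta> \<epsilon>)) (f x)"
    by (rule defines_gsf_represents[OF f x(1) r[OF x(2)]])
  show "moderate (\<lambda>\<epsilon>. mpderiv \<alpha> (\<lambda>y. u \<epsilon> (y + \<delta> \<epsilon>)) (\<xi> \<epsilon>))" for \<alpha>
    unfolding mpderiv_translate by (rule defines_gsf_moderate_mpderiv[OF f x(1) r[OF x(2)]])
qed

text \<open>
  A change of representative is a translation of the defining net by a negligible net, which avoids
  the mean value theorem (and derivatives out of the order of \<^const>\<open>coords\<close>).
\<close>

lemma negligible_mpderiv_diff:
  fixes U :: "(real^'n) gen set" and u v :: "real \<Rightarrow> real^'n \<Rightarrow> real"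
  assumes U: "openin sharp_topology U"
    and f: "defines_gsf \<Omega> u U f" "defines_gsf \<Omega>' v U f"
    and x: "x \<in> U" "represents \<xi> x" "represents \<eta> x"
  shows "negligible_net (\<lambda>\<epsilon>. mpderiv \<alpha> (u \<epsilon>) (\<xi> \<epsilon>) - mpderiv \<alpha> (v \<epsilon>) (\<eta> \<epsilon>))"
proof -
  define \<delta> where "\<delta> \<epsilon> = \<eta> \<epsilon> - \<xi> \<epsilon>" for \<epsilon>
  have "negligible_net \<delta>" using represents_unique[OF x(3,2)] unfolding \<delta>_def .
  note d = defines_gsf_translate[OF f(2) this]
  note w = defines_gsf_diff[OF f(1) d]
  \<comment> \<open>The difference net defines f - f = 0, so its values on \<open>U\<close> are
    negligible; \<open>negligible_mpderiv\<close> passes this on to its derivatives.\<close>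
  have negl: "negligible_net (\<lambda>\<epsilon>. mpderiv \<alpha> (\<lambda>y. u \<epsilon> y - v \<epsilon> (y + \<delta> \<epsilon>)) (\<xi> \<epsilon>))"
  proof (rule negligible_mpderiv[OF U _ _ _ _ x(1,2)])
    show "U \<subseteq> strongly_internal_set (\<lambda>\<epsilon>. \<Omega> \<epsilon> \<inter> {y. y + \<delta> \<epsilon> \<in> \<Omega>' \<epsilon>})"
      using w by (simp add: defines_gsf_def)
    show "smooth_on (\<Omega> \<epsilon> \<inter> {y. y + \<delta> \<epsilon> \<in> \<Omega>' \<epsilon>}) (\<lambda>y. u \<epsilon> y - v \<epsilon> (y + \<delta> \<epsilon>))" if "\<epsilon> \<in> {0<..1}" for \<epsilon>
      using defines_gsf_smooth[OF w that] by simp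
    show "negligible_net (\<lambda>\<epsilon>. u \<epsilon> (\<zeta> \<epsilon>) - v \<epsilon> (\<zeta> \<epsilon> + \<delta> \<epsilon>))" if "y \<in> U" "represents \<zeta> y" for y \<zeta>
      using defines_gsf_represents[OF w that] by (simp add: represents_zero_iff)
  qed (rule defines_gsf_moderate_mpderiv[OF w])
  have "\<forall>\<^sub>F \<epsilon> in at_right 0. \<xi> \<epsilon> \<in> \<Omega> \<epsilon> \<inter> {y. y + \<delta> \<epsilon> \<in> \<Omega>' \<epsilon>}"
    using w x unfolding defines_gsf_def strongly_internal_set_def by blast
  then have "\<forall>\<^sub>F \<epsilon> in at_right 0. norm (mpderiv \<alpha> (u \<epsilon>) (\<xi> \<epsilon>) - mpderiv \<alpha> (v \<epsilon>) (\<eta> \<epsilon>)) \<le>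
      norm (mpderiv \<alpha> (\<lambda>y. u \<epsilon> y - v \<epsilon> (y + \<delta> \<epsilon>)) (\<xi> \<epsilon>))"
    using eventually_small[of 1, simplified]
  proof eventually_elim
    case (elim \<epsilon>)
    then have \<epsilon>: "\<epsilon> \<in> {0<..1}" by simp
    note s = defines_gsf_smooth[OF f(1) \<epsilon>] defines_gsf_smooth[OF d \<epsilon>] defines_gsf_smooth[OF w \<epsilon>]
    have "mpderiv \<alpha> (\<lambda>y. u \<epsilon> y - v \<epsilon> (y + \<delta> \<epsilon>)) (\<xi> \<epsilon>) =
        mpderiv \<alpha> (u \<epsilon>) (\<xi> \<epsilon>) - mpderiv \<alpha> (\<lambda>y. v \<epsilon> (y + \<delta> \<epsilon>)) (\<xi> \<epsilon>)"
      using s by (intro mpderiv_diff[OF _ _ _ elim(1)]) (auto intro: smooth_on_subset)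
    then show ?case by (simp add: mpderiv_translate \<delta>_def)
  qed
  then show ?thesis by (rule negligible_net_bound[OF negl])
qed

text \<open>Uniqueness in the definite description, over defining nets and representatives alike, is
  \<open>negligible_mpderiv_diff\<close>. From here on derivatives are computed with whatever net is
  at hand.\<close>

lemma represents_gsf_deriv:
  fixes U :: "(real^'n) gen set" and u :: "real \<Rightarrow> real^'n \<Rightarrow> real"
  assumes U: "openin sharp_topology U" and f: "defines_gsf \<Omega> u U f"
    and x: "x \<in> U" "represents \<xi> x"
  shows "represents (\<lambda>\<epsilon>. mpderiv \<alpha> (u \<epsilon>) (\<xi> \<epsilon>)) (gsf_deriv U \<alpha> f x)"
proof -
  define y where "y = abs_gen (\<lambda>\<epsilon>. mpderiv \<alpha> (u \<epsilon>) (\<xi> \<epsilon>))"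
  have y: "represents (\<lambda>\<epsilon>. mpderiv \<alpha> (u \<epsilon>) (\<xi> \<epsilon>)) y"
    unfolding y_def by (intro represents_abs_gen defines_gsf_moderate_mpderiv[OF f x])
  have "gsf_deriv U \<alpha> f x = y"
    unfolding gsf_deriv_def
  proof (rule the_equality)
    fix z assume "\<exists>\<Omega> u \<xi>. defines_gsf \<Omega> u U f \<and> represents \<xi> x \<and>
        represents (\<lambda>\<epsilon>. mpderiv \<alpha> (u \<epsilon>) (\<xi> \<epsilon>)) z"
    then obtain \<Omega>' v \<eta> where v: "defines_gsf \<Omega>' v U f" "represents \<eta> x"
      "represents (\<lambda>\<epsilon>. mpderiv \<alpha> (v \<epsilon>) (\<eta> \<epsilon>)) z" by blast
    show "z = y"
      by (rule represents_eqI[OF v(3) y negligible_mpderiv_diff[OF U f v(1) x v(2)]])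
  qed (use f x y in blast)
  then show ?thesis using y by simp
qed

section \<open>Functionally compact sets and attained seminorms\<close>

text \<open>Supplies what selections from \<open>A \<epsilon>\<close> need: a natural exponent,
  obtained by rounding up, and non-emptiness for small \<epsilon>, witnessed by a representative of
  a point of \<open>K\<close>.\<close>

lemma functionally_compactE:
  fixes K :: "'a::real_normed_vector gen set"
  assumes "functionally_compact K" "K \<noteq> {}"
  obtains A and N :: nat
  where "K = internal_set A" "\<And>\<epsilon>. \<epsilon> \<in> {0<..1} \<Longrightarrow> compact (A \<epsilon>)"
    and "\<forall>\<^sub>F \<epsilon> in at_right 0. A \<epsilon> \<noteq> {} \<and> (\<forall>x\<in>A \<epsilon>. norm x \<le> inverse \<epsilon> ^ N)"
proof -
  obtain A r where A: "\<forall>\<epsilon>\<in>{0<..1}. compact (A \<epsilon>)" "K = internal_set A"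
    and r: "\<forall>\<^sub>F \<epsilon> in at_right 0. \<forall>x\<in>A \<epsilon>. norm x \<le> \<epsilon> powr (- r)"
    using assms(1) unfolding functionally_compact_def by blast
  have "\<forall>\<^sub>F \<epsilon> in at_right 0. A \<epsilon> \<noteq> {}"
  proof -
    obtain u where "\<forall>\<^sub>F \<epsilon> in at_right 0. u \<epsilon> \<in> A \<epsilon>"
      using assms(2) A(2) by (auto simp: internal_set_def)
    then show ?thesis by eventually_elim auto
  qed
  then have "\<forall>\<^sub>F \<epsilon> in at_right 0. A \<epsilon> \<noteq> {} \<and> (\<forall>x\<in>A \<epsilon>. norm x \<le> inverse \<epsilon> ^ nat \<lceil>r\<rceil>)"
    using r eventually_small[of 1, simplified]
  proof eventually_elim
    case (elim \<epsilon>)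
    have "\<epsilon> powr (- r) \<le> \<epsilon> powr (- real (nat \<lceil>r\<rceil>))"
      using elim real_nat_ceiling_ge[of r] by (intro powr_mono') auto
    also have "\<dots> = inverse \<epsilon> ^ nat \<lceil>r\<rceil>"
      using elim by (simp add: powr_minus powr_realpow power_inverse)
    finally show ?case using elim by (meson order_trans)
  qed
  then show ?thesis using that A by blast
qed

text \<open>Turns \<epsilon>-wise selections, such as maximisers or nearest points, into generalized
  points: the common bound on \<open>A\<close> makes any of them moderate.\<close>

lemma internal_set_bounded_net:
  assumes "\<forall>\<^sub>F \<epsilon> in at_right 0. \<forall>x\<in>A \<epsilon>. norm x \<le> inverse \<epsilon> ^ N"
    and "\<forall>\<^sub>F \<epsilon> in at_right 0. \<xi> \<epsilon> \<in> A \<epsilon>"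
  shows "represents \<xi> (abs_gen \<xi>)" "abs_gen \<xi> \<in> internal_set A"
proof -
  have "\<forall>\<^sub>F \<epsilon> in at_right 0. norm (\<xi> \<epsilon>) \<le> inverse \<epsilon> ^ N"
    using assms by eventually_elim auto
  then have "moderate \<xi>" using moderate_iff by blast
  then show "represents \<xi> (abs_gen \<xi>)" by (rule represents_abs_gen)
  then show "abs_gen \<xi> \<in> internal_set A" using assms(2) by (auto simp: internal_set_def)
qed

text \<open>The maximiser is chosen separately on each compact \<open>A \<epsilon>\<close>. Every
  point of \<open>K\<close> is compared with it through a representative lying in \<open>A\<close>,
  where maximality is a plain inequality of reals.\<close>

lemma gmaximum_gsf_deriv_attained:
  fixes U K :: "(real^'n) gen set" and u :: "real \<Rightarrow> real^'n \<Rightarrow> real"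
  assumes U: "openin sharp_topology U" and f: "defines_gsf (\<lambda>_. UNIV) u U f"
    and K: "functionally_compact K" "K \<noteq> {}" "K \<subseteq> U"
  obtains a where "a \<in> K"
    "gmaximum ((\<lambda>x. gnorm (gsf_deriv U \<alpha> f x)) ` K) = gnorm (gsf_deriv U \<alpha> f a)"
    "\<And>x. x \<in> K \<Longrightarrow> gnorm (gsf_deriv U \<alpha> f x) \<le>\<^sub>g gnorm (gsf_deriv U \<alpha> f a)"
proof -
  obtain A N where A: "K = internal_set A" "\<And>\<epsilon>. \<epsilon> \<in> {0<..1} \<Longrightarrow> compact (A \<epsilon>)"
    "\<forall>\<^sub>F \<epsilon> in at_right 0. A \<epsilon> \<noteq> {} \<and> (\<forall>x\<in>A \<epsilon>. norm x \<le> inverse \<epsilon> ^ N)"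
    using functionally_compactE[OF K(1,2)] by blast
  define w where "w \<epsilon> y = norm (mpderiv \<alpha> (u \<epsilon>) y)" for \<epsilon> y
  define \<xi> where "\<xi> \<epsilon> = (SOME y. y \<in> A \<epsilon> \<and> (\<forall>z\<in>A \<epsilon>. w \<epsilon> z \<le> w \<epsilon> y))" for \<epsilon>
  have \<xi>: "\<forall>\<^sub>F \<epsilon> in at_right 0. \<xi> \<epsilon> \<in> A \<epsilon> \<and> (\<forall>z\<in>A \<epsilon>. w \<epsilon> z \<le> w \<epsilon> (\<xi> \<epsilon>))"
    using A(3) eventually_small[of 1, simplified]
  proof eventually_elim
    case (elim \<epsilon>)
    then have \<epsilon>: "\<epsilon> \<in> {0<..1}" by simp
    have "continuous_on UNIV (mpderiv \<alpha> (u \<epsilon>))"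
      using defines_gsf_smooth[OF f \<epsilon>] smooth_on_mpderiv smooth_on_imp_continuous_on by blast
    then have "continuous_on (A \<epsilon>) (w \<epsilon>)"
      unfolding w_def by (intro continuous_on_norm) (rule continuous_on_subset, auto)
    then have "\<exists>y. y \<in> A \<epsilon> \<and> (\<forall>z\<in>A \<epsilon>. w \<epsilon> z \<le> w \<epsilon> y)"
      using continuous_attains_sup[OF A(2)[OF \<epsilon>]] elim by blast
    then show ?case unfolding \<xi>_def by (rule someI_ex)
  qed
  have Ab: "\<forall>\<^sub>F \<epsilon> in at_right 0. \<forall>x\<in>A \<epsilon>. norm x \<le> inverse \<epsilon> ^ N"
    using A(3) by eventually_elim auto
  have \<xi>A: "\<forall>\<^sub>F \<epsilon> in at_right 0. \<xi> \<epsilon> \<in> A \<epsilon>" using \<xi> by eventually_elim auto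
  define a where "a = abs_gen \<xi>"
  have a: "represents \<xi> a" "a \<in> K"
    unfolding a_def A(1)
    by (rule internal_set_bounded_net[OF Ab \<xi>A])+
  have le: "gnorm (gsf_deriv U \<alpha> f x) \<le>\<^sub>g gnorm (gsf_deriv U \<alpha> f a)" if "x \<in> K" for x
  proof -
    obtain \<eta> where \<eta>: "represents \<eta> x" "\<forall>\<^sub>F \<epsilon> in at_right 0. \<eta> \<epsilon> \<in> A \<epsilon>"
      using \<open>x \<in> K\<close> A(1) by (auto simp: internal_set_def)
    have "represents (\<lambda>\<epsilon>. w \<epsilon> (\<eta> \<epsilon>)) (gnorm (gsf_deriv U \<alpha> f x))"
      "represents (\<lambda>\<epsilon>. w \<epsilon> (\<xi> \<epsilon>)) (gnorm (gsf_deriv U \<alpha> f a))"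
      unfolding w_def using a(2) that K(3)
      by (intro represents_gnorm represents_gsf_deriv[OF U f _ \<eta>(1)]
          represents_gsf_deriv[OF U f _ a(1)]; blast)+
    moreover have "\<forall>\<^sub>F \<epsilon> in at_right 0. w \<epsilon> (\<eta> \<epsilon>) \<le> w \<epsilon> (\<xi> \<epsilon>)"
      using \<eta>(2) \<xi> by eventually_elim auto
    ultimately show ?thesis unfolding gle_def by blast
  qed
  have "gmaximum ((\<lambda>x. gnorm (gsf_deriv U \<alpha> f x)) ` K) = gnorm (gsf_deriv U \<alpha> f a)"
    by (rule gmaximum_eqI) (use a le in auto)
  then show ?thesis using that a le by blast
qed

text \<open>A strict bound passes through both maxima: the one over \<open>K\<close> is attained,
  the one over the multi-indices ranges over a finite set. Seminorms are used below only in this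
  pointwise form.\<close>

lemma GD_norm_gless_iff:
  fixes U K :: "(real^'n) gen set" and u :: "real \<Rightarrow> real^'n \<Rightarrow> real"
  assumes U: "openin sharp_topology U" and f: "defines_gsf (\<lambda>_. UNIV) u U f"
    and K: "functionally_compact K" "K \<noteq> {}" "K \<subseteq> U"
  shows "GD_norm K U m f <\<^sub>g \<rho> \<longleftrightarrow>
    (\<forall>\<alpha>\<in>multi_indices_upto m. \<forall>x\<in>K. gnorm (gsf_deriv U \<alpha> f x) <\<^sub>g \<rho>)"
proof
  assume *: "GD_norm K U m f <\<^sub>g \<rho>"
  show "\<forall>\<alpha>\<in>multi_indices_upto m. \<forall>x\<in>K. gnorm (gsf_deriv U \<alpha> f x) <\<^sub>g \<rho>"
  proof (intro ballI)
    fix \<alpha> :: "'n \<Rightarrow> nat" and x assume \<alpha>: "\<alpha> \<in> multi_indices_upto m" and x: "x \<in> K"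
    have "gmaximum ((\<lambda>x. gnorm (gsf_deriv U \<alpha> f x)) ` K) <\<^sub>g \<rho>"
      using gless_trans_gle[OF gle_gMax[OF finite_multi_indices \<alpha>]] * unfolding GD_norm_def by blast
    then show "gnorm (gsf_deriv U \<alpha> f x) <\<^sub>g \<rho>"
      using gmaximum_gsf_deriv_attained[OF U f K, of \<alpha>] x gless_trans_gle by metis
  qed
next
  assume *: "\<forall>\<alpha>\<in>multi_indices_upto m. \<forall>x\<in>K. gnorm (gsf_deriv U \<alpha> f x) <\<^sub>g \<rho>"
  have "(\<lambda>_. 0) \<in> (multi_indices_upto m :: ('n \<Rightarrow> nat) set)" by (simp add: multi_indices_upto_def)
  then show "GD_norm K U m f <\<^sub>g \<rho>"
    unfolding GD_norm_def
  proof (intro gMax_gless finite_multi_indices)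
    fix \<alpha> :: "'n \<Rightarrow> nat" assume "\<alpha> \<in> multi_indices_upto m"
    then show "gmaximum ((\<lambda>x. gnorm (gsf_deriv U \<alpha> f x)) ` K) <\<^sub>g \<rho>"
      using gmaximum_gsf_deriv_attained[OF U f K, of \<alpha>] * by metis
  qed auto
qed

lemma defines_gsf_cong:
  assumes "\<And>x. x \<in> U \<Longrightarrow> f x = g x"
  shows "defines_gsf \<Omega> u U f \<longleftrightarrow> defines_gsf \<Omega> u U g"
  using assms by (simp add: defines_gsf_def)

lemma GD_dist_gless_iff:
  fixes U K :: "(real^'n) gen set" and u v :: "real \<Rightarrow> real^'n \<Rightarrow> real"
  assumes U: "openin sharp_topology U"
    and f: "defines_gsf (\<lambda>_. UNIV) u U f" and g: "defines_gsf (\<lambda>_. UNIV) v U g"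
    and K: "functionally_compact K" "K \<noteq> {}" "K \<subseteq> U"
  shows "GD_dist K U m f g <\<^sub>g \<rho> \<longleftrightarrow>
    (\<forall>\<alpha>\<in>multi_indices_upto m. \<forall>x\<in>K. gnorm (gsf_deriv U \<alpha> (\<lambda>x\<in>U. f x - g x) x) <\<^sub>g \<rho>)"
    and "defines_gsf (\<lambda>_. UNIV) (\<lambda>\<epsilon> y. u \<epsilon> y - v \<epsilon> y) U (\<lambda>x\<in>U. f x - g x)"
proof -
  show d: "defines_gsf (\<lambda>_. UNIV) (\<lambda>\<epsilon> y. u \<epsilon> y - v \<epsilon> y) U (\<lambda>x\<in>U. f x - g x)"
    using defines_gsf_diff[OF f g] defines_gsf_cong[of U "\<lambda>x. f x - g x" "\<lambda>x\<in>U. f x - g x"] by simp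
  show "GD_dist K U m f g <\<^sub>g \<rho> \<longleftrightarrow>
    (\<forall>\<alpha>\<in>multi_indices_upto m. \<forall>x\<in>K. gnorm (gsf_deriv U \<alpha> (\<lambda>x\<in>U. f x - g x) x) <\<^sub>g \<rho>)"
    unfolding GD_dist_def by (rule GD_norm_gless_iff[OF U d K])
qed

section \<open>From seminorms to uniform bounds on balls\<close>

text \<open>The radius separating the two cases comes out of the first one. A net has to be close to
  \<open>A\<close> at every power of \<epsilon> to represent a point of \<open>K\<close>, but
  uniformity returns one power \<epsilon>^q, and keeping that distance from \<open>A\<close>
  suffices for lying in ext(K).\<close>

lemma eventually_mpderiv_bounded:
  fixes U K :: "(real^'n) gen set" and w :: "real \<Rightarrow> real^'n \<Rightarrow> real"
  assumes U: "openin sharp_topology U" and h: "defines_gsf (\<lambda>_. UNIV) w U h"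
    and K: "functionally_compact K" "K \<noteq> {}" "K \<subseteq> U"
    and ext: "\<And>x \<xi>. x \<in> gen_ext K \<Longrightarrow> represents \<xi> x \<Longrightarrow>
      negligible_net (\<lambda>\<epsilon>. mpderiv \<alpha> (w \<epsilon>) (\<xi> \<epsilon>))"
    and bound: "\<And>x. x \<in> K \<Longrightarrow> gnorm (gsf_deriv U \<alpha> h x) <\<^sub>g abs_gen (\<lambda>\<epsilon>. \<epsilon> ^ k)"
  shows "\<forall>\<^sub>F \<epsilon> in at_right 0. \<forall>y. norm y \<le> inverse \<epsilon> ^ M \<longrightarrow> \<bar>mpderiv \<alpha> (w \<epsilon>) y\<bar> \<le> \<epsilon> ^ k"
proof -
  obtain A N where A: "K = internal_set A" "\<And>\<epsilon>. \<epsilon> \<in> {0<..1} \<Longrightarrow> compact (A \<epsilon>)"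
    "\<forall>\<^sub>F \<epsilon> in at_right 0. A \<epsilon> \<noteq> {} \<and> (\<forall>x\<in>A \<epsilon>. norm x \<le> inverse \<epsilon> ^ N)"
    using functionally_compactE[OF K(1,2)] by blast
  have Ab: "\<forall>\<^sub>F \<epsilon> in at_right 0. \<forall>x\<in>A \<epsilon>. norm x \<le> inverse \<epsilon> ^ N"
    using A(3) by eventually_elim auto
  have "\<exists>q. \<forall>\<^sub>F \<epsilon> in at_right 0. \<forall>y.
      (\<exists>a\<in>A \<epsilon>. norm (y - a) \<le> \<epsilon> ^ q) \<longrightarrow> \<bar>mpderiv \<alpha> (w \<epsilon>) y\<bar> \<le> \<epsilon> ^ k"
  proof (rule nets_uniform)
    show "\<exists>a\<in>A \<epsilon>. norm (y - a) \<le> \<epsilon> ^ p"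
      if "p \<le> q" "0 < \<epsilon>" "\<epsilon> < 1" "\<exists>a\<in>A \<epsilon>. norm (y - a) \<le> \<epsilon> ^ q" for p q \<epsilon> y
      using that power_decreasing[of p q \<epsilon>] by (meson less_imp_le order_trans)
    show "\<forall>\<^sub>F \<epsilon> in at_right 0. \<exists>a\<in>A \<epsilon>. norm ((SOME a. a \<in> A \<epsilon>) - a) \<le> \<epsilon> ^ q" for q
      using A(3) eventually_small[of 1, simplified]
    proof eventually_elim
      case (elim \<epsilon>)
      then show ?case by (intro bexI[of _ "SOME a. a \<in> A \<epsilon>"]) (auto simp: some_in_eq)
    qed
    fix \<xi> assume \<xi>: "\<And>q. \<forall>\<^sub>F \<epsilon> in at_right 0. \<exists>a\<in>A \<epsilon>. norm (\<xi> \<epsilon> - a) \<le> \<epsilon> ^ q"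
    \<comment> \<open>A nearest point of the closed set \<open>A \<epsilon>\<close> meets the
      closeness conditions for all q at once; hence \<open>\<xi>\<close> itself represents a point
      of \<open>K\<close>.\<close>
    define c where "c \<epsilon> = (SOME a. a \<in> A \<epsilon> \<and> (\<forall>b\<in>A \<epsilon>. dist (\<xi> \<epsilon>) a \<le> dist (\<xi> \<epsilon>) b))" for \<epsilon>
    have c: "\<forall>\<^sub>F \<epsilon> in at_right 0. c \<epsilon> \<in> A \<epsilon> \<and> (\<forall>b\<in>A \<epsilon>. dist (\<xi> \<epsilon>) (c \<epsilon>) \<le> dist (\<xi> \<epsilon>) b)"
      using A(3) eventually_small[of 1, simplified]
    proof eventually_elim
      case (elim \<epsilon>)
      then have "closed (A \<epsilon>)" "A \<epsilon> \<noteq> {}" using A(2) by (auto intro: compact_imp_closed)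
      then have "\<exists>a. a \<in> A \<epsilon> \<and> (\<forall>b\<in>A \<epsilon>. dist (\<xi> \<epsilon>) a \<le> dist (\<xi> \<epsilon>) b)"
        by (rule distance_attains_inf) blast
      then show ?case unfolding c_def by (rule someI_ex)
    qed
    have cA: "\<forall>\<^sub>F \<epsilon> in at_right 0. c \<epsilon> \<in> A \<epsilon>" using c by eventually_elim auto
    define x where "x = abs_gen c"
    have x: "represents c x" "x \<in> K"
      unfolding x_def A(1) by (rule internal_set_bounded_net[OF Ab cA])+
    have "negligible_net (\<lambda>\<epsilon>. \<xi> \<epsilon> - c \<epsilon>)"
      unfolding negligible_net_iff
    proof
      show "\<forall>\<^sub>F \<epsilon> in at_right 0. norm (\<xi> \<epsilon> - c \<epsilon>) \<le> \<epsilon> ^ m" for m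
        using \<xi>[of m] c by eventually_elim (force simp: dist_norm)
    qed
    then have x\<xi>: "represents \<xi> x" by (rule represents_cong[OF x(1)])
    have "represents (\<lambda>\<epsilon>. norm (mpderiv \<alpha> (w \<epsilon>) (\<xi> \<epsilon>))) (gnorm (gsf_deriv U \<alpha> h x))"
      using x(2) K(3) by (intro represents_gnorm represents_gsf_deriv[OF U h _ x\<xi>]) auto
    then obtain q :: nat
      where "\<forall>\<^sub>F \<epsilon> in at_right 0. \<epsilon> ^ q \<le> \<epsilon> ^ k - norm (mpderiv \<alpha> (w \<epsilon>) (\<xi> \<epsilon>))"
      using gless_iff[OF _ represents_abs_gen[OF moderate_power]] bound[OF x(2)] by blast
    then have "\<forall>\<^sub>F \<epsilon> in at_right 0. \<bar>mpderiv \<alpha> (w \<epsilon>) (\<xi> \<epsilon>)\<bar> \<le> \<epsilon> ^ k"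
      using eventually_small[of 1, simplified]
    proof eventually_elim
      case (elim \<epsilon>)
      then have "0 \<le> \<epsilon> ^ q" by simp
      then show ?case using elim(1) unfolding real_norm_def by linarith
    qed
    then show "\<exists>q::nat. \<forall>\<^sub>F \<epsilon> in at_right 0. \<bar>mpderiv \<alpha> (w \<epsilon>) (\<xi> \<epsilon>)\<bar> \<le> \<epsilon> ^ k" by blast
  qed
  then obtain q where near: "\<forall>\<^sub>F \<epsilon> in at_right 0. \<forall>y.
      (\<exists>a\<in>A \<epsilon>. norm (y - a) \<le> \<epsilon> ^ q) \<longrightarrow> \<bar>mpderiv \<alpha> (w \<epsilon>) y\<bar> \<le> \<epsilon> ^ k" by blast
  \<comment> \<open>Enlarging M makes room for the default net of \<open>nets_uniform\<close>: a
    vector of norm \<epsilon>^(-M') \<ge> 2 \<epsilon>^(-N) keeps distance at least 1 from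
    \<open>A \<epsilon>\<close>.\<close>
  define M' where "M' = max M (Suc N)"
  have "\<exists>p::nat. \<forall>\<^sub>F \<epsilon> in at_right 0. \<forall>y.
      (norm y \<le> inverse \<epsilon> ^ M' \<and> (\<forall>a\<in>A \<epsilon>. \<epsilon> ^ q \<le> norm (y - a))) \<longrightarrow>
      \<bar>mpderiv \<alpha> (w \<epsilon>) y\<bar> \<le> \<epsilon> ^ k"
  proof (rule nets_uniform)
    let ?d = "\<lambda>\<epsilon>. (inverse \<epsilon> ^ M') *\<^sub>R axis undefined (1::real) :: real^'n"
    show "\<forall>\<^sub>F \<epsilon> in at_right 0. norm (?d \<epsilon>) \<le> inverse \<epsilon> ^ M' \<and> (\<forall>a\<in>A \<epsilon>. \<epsilon> ^ q \<le> norm (?d \<epsilon> - a))"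
      for p :: nat
      using Ab eventually_small[of "1/2", simplified]
    proof eventually_elim
      case (elim \<epsilon>)
      then have e: "0 < \<epsilon>" "\<epsilon> < 1" "2 \<le> inverse \<epsilon>" by (auto simp: field_simps)
      have n: "norm (?d \<epsilon>) = inverse \<epsilon> ^ M'" using e by simp
      have "2 * inverse \<epsilon> ^ N \<le> inverse \<epsilon> * inverse \<epsilon> ^ N" using e by (intro mult_right_mono) auto
      also have "\<dots> = inverse \<epsilon> ^ Suc N" by simp
      also have "\<dots> \<le> inverse \<epsilon> ^ M'" using e by (intro power_increasing) (auto simp: M'_def)
      finally have 2: "2 * inverse \<epsilon> ^ N \<le> inverse \<epsilon> ^ M'" .
      have 1: "1 \<le> inverse \<epsilon> ^ N" "\<epsilon> ^ q \<le> 1" using e by (auto intro!: one_le_power power_le_one)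
      have "\<epsilon> ^ q \<le> norm (?d \<epsilon> - a)" if "a \<in> A \<epsilon>" for a
      proof -
        have "norm (?d \<epsilon>) - norm a \<le> norm (?d \<epsilon> - a)" by (rule norm_triangle_ineq2)
        moreover have "norm a \<le> inverse \<epsilon> ^ N" using elim that by blast
        ultimately show ?thesis using 1 2 unfolding n by linarith
      qed
      then show ?case using n by simp
    qed
    fix \<xi> assume *: "\<And>p::nat. \<forall>\<^sub>F \<epsilon> in at_right 0.
      norm (\<xi> \<epsilon>) \<le> inverse \<epsilon> ^ M' \<and> (\<forall>a\<in>A \<epsilon>. \<epsilon> ^ q \<le> norm (\<xi> \<epsilon> - a))"
    then have "\<forall>\<^sub>F \<epsilon> in at_right 0. norm (\<xi> \<epsilon>) \<le> inverse \<epsilon> ^ M'" by (auto elim: eventually_mono)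
    then have "moderate \<xi>" using moderate_iff by blast
    then have x: "represents \<xi> (abs_gen \<xi>)" by (rule represents_abs_gen)
    have "abs_gen \<xi> \<in> gen_ext K"
      unfolding gen_ext_def
    proof (intro CollectI ballI)
      fix b assume "b \<in> K"
      then obtain \<beta> where \<beta>: "represents \<beta> b" "\<forall>\<^sub>F \<epsilon> in at_right 0. \<beta> \<epsilon> \<in> A \<epsilon>"
        using A(1) by (auto simp: internal_set_def)
      have "represents (\<lambda>\<epsilon>. norm (\<xi> \<epsilon> - \<beta> \<epsilon>)) (gnorm (abs_gen \<xi> - b))"
        by (intro represents_gnorm represents_minus x \<beta>)
      moreover have "represents (\<lambda>_. 0) (0::real gen)"
        by (simp add: represents_zero_iff negligible_net_zero)
      moreover have "\<forall>\<^sub>F \<epsilon> in at_right 0. \<epsilon> ^ q \<le> norm (\<xi> \<epsilon> - \<beta> \<epsilon>) - 0"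
        using * \<beta>(2) by eventually_elim auto
      ultimately show "0 <\<^sub>g gnorm (abs_gen \<xi> - b)" using gless_iff by blast
    qed
    then have "negligible_net (\<lambda>\<epsilon>. mpderiv \<alpha> (w \<epsilon>) (\<xi> \<epsilon>))" using x by (rule ext)
    then show "\<exists>p::nat. \<forall>\<^sub>F \<epsilon> in at_right 0. \<bar>mpderiv \<alpha> (w \<epsilon>) (\<xi> \<epsilon>)\<bar> \<le> \<epsilon> ^ k"
      unfolding negligible_net_iff real_norm_def by blast
  qed
  then have "\<forall>\<^sub>F \<epsilon> in at_right 0. \<forall>y.
      (norm y \<le> inverse \<epsilon> ^ M' \<and> (\<forall>a\<in>A \<epsilon>. \<epsilon> ^ q \<le> norm (y - a))) \<longrightarrow>
      \<bar>mpderiv \<alpha> (w \<epsilon>) y\<bar> \<le> \<epsilon> ^ k" by blast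
  then show ?thesis
    using near eventually_small[of 1, simplified]
  proof eventually_elim
    case (elim \<epsilon>)
    have "inverse \<epsilon> ^ M \<le> inverse \<epsilon> ^ M'"
      using elim by (intro power_increasing) (auto simp: M'_def one_le_inverse_iff)
    then show ?case using elim by (meson linear order_trans)
  qed
qed

section \<open>Completeness\<close>

lemma mpderiv_zero: "mpderiv (\<lambda>_. 0) u = u"
proof -
  have "foldr (\<lambda>i. pderiv_at i ^^ 0) cs u = u" for cs by (induction cs) auto
  then show ?thesis by (simp add: mpderiv_def)
qed

lemma multi_indices_upto_mono: "k \<le> l \<Longrightarrow> \<alpha> \<in> multi_indices_upto k \<Longrightarrow> \<alpha> \<in> multi_indices_upto l"
  by (simp add: multi_indices_upto_def)

lemma gless_zero_power: "0 <\<^sub>g abs_gen (\<lambda>\<epsilon>. \<epsilon> ^ k)"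
proof -
  have "represents (\<lambda>_. 0) (0::real gen)" by (simp add: represents_zero_iff negligible_net_zero)
  then show ?thesis
    by (simp add: gless_iff[OF _ represents_abs_gen[OF moderate_power]] exI[of _ k])
qed

theorem theorem48:
  fixes U K :: "(real^'n) gen set"
  assumes "openin sharp_topology U" and "U \<noteq> {}"
    and "functionally_compact K" and "K \<noteq> {}" and "K \<subseteq> U"
  shows "GD_complete K U"
  unfolding GD_complete_def
proof (intro allI impI)
  note U = assms(1) and K = assms(3-5)
  fix f assume cauchy: "GD_Cauchy K U f"
  have "\<exists>u. defines_gsf (\<lambda>_. UNIV) u U (f i) \<and>
     (\<forall>x\<in>gen_ext K. \<forall>\<xi>. represents \<xi> x \<longrightarrow>
        (\<forall>\<alpha>. negligible_net (\<lambda>\<epsilon>. mpderiv \<alpha> (u \<epsilon>) (\<xi> \<epsilon>))))" for i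
    using cauchy unfolding GD_Cauchy_def GD_def represents_zero_iff by blast
  then obtain u where u: "\<And>i. defines_gsf (\<lambda>_. UNIV) (u i) U (f i)"
    and ext: "\<And>i x \<xi> \<alpha>. x \<in> gen_ext K \<Longrightarrow> represents \<xi> x \<Longrightarrow>
      negligible_net (\<lambda>\<epsilon>. mpderiv \<alpha> (u i \<epsilon>) (\<xi> \<epsilon>))" by metis
  have smooth: "smooth_on UNIV (u i \<epsilon>)" if "\<epsilon> \<in> {0<..1}" for i \<epsilon>
    using defines_gsf_smooth[OF u that] by simp
  have mdiff: "mpderiv \<alpha> (\<lambda>y. u i \<epsilon> y - u j \<epsilon> y) y = mpderiv \<alpha> (u i \<epsilon>) y - mpderiv \<alpha> (u j \<epsilon>) y"
    if "\<epsilon> \<in> {0<..1}" for \<alpha> i j \<epsilon> y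
    using mpderiv_diff[OF open_UNIV smooth[OF that] smooth[OF that]] by simp
  have "\<exists>n. \<forall>i\<ge>n. \<forall>j\<ge>n. GD_dist K U k (f i) (f j) <\<^sub>g abs_gen (\<lambda>\<epsilon>. \<epsilon> ^ k)" for k
    using cauchy gless_zero_power unfolding GD_Cauchy_def by blast
  then obtain n where n: "\<And>k i j. n k \<le> i \<Longrightarrow> n k \<le> j \<Longrightarrow>
      GD_dist K U k (f i) (f j) <\<^sub>g abs_gen (\<lambda>\<epsilon>. \<epsilon> ^ k)" by metis
  \<comment> \<open>This holds for every M, but only below a threshold for \<epsilon> that depends
    on i, j and M; this dependence is what the diagonal choice has to absorb.\<close>
  have est: "\<forall>\<^sub>F \<epsilon> in at_right 0. \<forall>\<alpha>\<in>multi_indices_upto k. \<forall>y. norm y \<le> inverse \<epsilon> ^ M \<longrightarrow>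
      \<bar>mpderiv \<alpha> (u i \<epsilon>) y - mpderiv \<alpha> (u j \<epsilon>) y\<bar> \<le> \<epsilon> ^ k" if "n k \<le> i" "n k \<le> j" for k i j M
  proof (intro eventually_ball_finite finite_multi_indices ballI)
    fix \<alpha> :: "'n \<Rightarrow> nat" assume \<alpha>: "\<alpha> \<in> multi_indices_upto k"
    note d = GD_dist_gless_iff[OF U u[of i] u[of j] K]
    have "\<forall>\<^sub>F \<epsilon> in at_right 0. \<forall>y. norm y \<le> inverse \<epsilon> ^ M \<longrightarrow>
        \<bar>mpderiv \<alpha> (\<lambda>y. u i \<epsilon> y - u j \<epsilon> y) y\<bar> \<le> \<epsilon> ^ k"
    proof (rule eventually_mpderiv_bounded[OF U d(2) K])
      fix x \<xi> assume x: "x \<in> gen_ext K" "represents \<xi> x"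
      show "negligible_net (\<lambda>\<epsilon>. mpderiv \<alpha> (\<lambda>y. u i \<epsilon> y - u j \<epsilon> y) (\<xi> \<epsilon>))"
        by (rule negligible_net_bound[OF negligible_net_diff[OF ext[OF x, of \<alpha> i] ext[OF x, of \<alpha> j]],
              OF eventually_mono[OF eventually_small[of 1, simplified]]]) (simp add: mdiff)
    qed (use d(1) n that \<alpha> in blast)
    then show "\<forall>\<^sub>F \<epsilon> in at_right 0. \<forall>y. norm y \<le> inverse \<epsilon> ^ M \<longrightarrow>
        \<bar>mpderiv \<alpha> (u i \<epsilon>) y - mpderiv \<alpha> (u j \<epsilon>) y\<bar> \<le> \<epsilon> ^ k"
      using eventually_small[of 1, simplified] by eventually_elim (simp add: mdiff)
  qed
  \<comment> \<open>The sum bounds n 0, ..., n l from above, so for k \<le> l both s k and s l lie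
    beyond n k.\<close>
  define s where "s l = (\<Sum>j\<le>l. n j)" for l
  have s: "n k \<le> s l" if "k \<le> l" for k l
    unfolding s_def using that by (intro member_le_sum) auto
  \<comment> \<open>Every earlier s k is compared directly with s l, so errors are not summed along
    the subsequence.\<close>
  define P where "P l \<epsilon> \<longleftrightarrow> (\<forall>k\<in>{..l}. \<forall>\<alpha>\<in>multi_indices_upto k. \<forall>y. norm y \<le> inverse \<epsilon> ^ k \<longrightarrow>
      \<bar>mpderiv \<alpha> (u (s l) \<epsilon>) y - mpderiv \<alpha> (u (s k) \<epsilon>) y\<bar> \<le> \<epsilon> ^ k)" for l \<epsilon>
  have "\<forall>\<^sub>F \<epsilon> in at_right 0. P l \<epsilon>" for l
    unfolding P_def by (intro eventually_ball_finite ballI est) (auto intro: s)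
  then obtain \<kappa> where \<kappa>: "\<And>k. \<forall>\<^sub>F \<epsilon> in at_right 0. k \<le> \<kappa> \<epsilon>" "\<forall>\<^sub>F \<epsilon> in at_right 0. P (\<kappa> \<epsilon>) \<epsilon>"
    using eventually_diagonal by blast
  define v where "v \<epsilon> = u (s (\<kappa> \<epsilon>)) \<epsilon>" for \<epsilon>
  \<comment> \<open>Since k \<le> \<open>\<kappa> \<epsilon>\<close> for small \<epsilon>, the
    diagonal net can be measured against one fixed net \<open>u (s k)\<close>, from which the
    properties of the limit are inherited.\<close>
  have key: "\<forall>\<^sub>F \<epsilon> in at_right 0. \<forall>\<alpha>\<in>multi_indices_upto k. \<forall>y. norm y \<le> inverse \<epsilon> ^ k \<longrightarrow>
      \<bar>mpderiv \<alpha> (v \<epsilon>) y - mpderiv \<alpha> (u (s k) \<epsilon>) y\<bar> \<le> \<epsilon> ^ k" for k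
    using \<kappa>(1)[of k] \<kappa>(2) by eventually_elim (auto simp: P_def v_def)
  \<comment> \<open>Two nets share one k because well-definedness of the limit compares two
    representatives. They are arbitrary moderate nets, since points of ext(K) need not lie in
    \<open>U\<close>.\<close>
  have close: "\<exists>k. \<forall>\<^sub>F \<epsilon> in at_right 0.
      \<bar>mpderiv \<alpha> (v \<epsilon>) (\<xi> \<epsilon>) - mpderiv \<alpha> (u k \<epsilon>) (\<xi> \<epsilon>)\<bar> \<le> \<epsilon> ^ m \<and>
      \<bar>mpderiv \<alpha> (v \<epsilon>) (\<eta> \<epsilon>) - mpderiv \<alpha> (u k \<epsilon>) (\<eta> \<epsilon>)\<bar> \<le> \<epsilon> ^ m"
    if mod: "moderate \<xi>" "moderate \<eta>" for \<alpha> \<xi> \<eta> m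
  proof -
    obtain M M' :: nat where M: "\<forall>\<^sub>F \<epsilon> in at_right 0. norm (\<xi> \<epsilon>) \<le> inverse \<epsilon> ^ M"
      "\<forall>\<^sub>F \<epsilon> in at_right 0. norm (\<eta> \<epsilon>) \<le> inverse \<epsilon> ^ M'"
      using mod unfolding moderate_iff by blast
    \<comment> \<open>m gives the accuracy, M and M' bring both nets into the ball, and the last
      summand covers the order of \<alpha>.\<close>
    define k where "k = m + M + M' + (\<Sum>i\<in>UNIV. \<alpha> i)"
    have \<alpha>: "\<alpha> \<in> multi_indices_upto k" by (simp add: multi_indices_upto_def k_def)
    have "\<forall>\<^sub>F \<epsilon> in at_right 0.
      \<bar>mpderiv \<alpha> (v \<epsilon>) (\<xi> \<epsilon>) - mpderiv \<alpha> (u (s k) \<epsilon>) (\<xi> \<epsilon>)\<bar> \<le> \<epsilon> ^ m \<and>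
      \<bar>mpderiv \<alpha> (v \<epsilon>) (\<eta> \<epsilon>) - mpderiv \<alpha> (u (s k) \<epsilon>) (\<eta> \<epsilon>)\<bar> \<le> \<epsilon> ^ m"
      using key[of k] M eventually_small[of 1, simplified]
    proof eventually_elim
      case (elim \<epsilon>)
      have "\<epsilon> ^ k \<le> \<epsilon> ^ m" using elim by (intro power_decreasing) (auto simp: k_def)
      moreover have "inverse \<epsilon> ^ M \<le> inverse \<epsilon> ^ k" "inverse \<epsilon> ^ M' \<le> inverse \<epsilon> ^ k"
        using elim by (auto intro!: power_increasing simp: k_def one_le_inverse_iff)
      ultimately show ?case using elim \<alpha> by (meson order_trans)
    qed
    then show ?thesis by blast
  qed
  \<comment> \<open>A provisional choice of representatives; independence of it is established in
    the fact \<open>g\<close> below.\<close>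
  define g where "g = (\<lambda>x\<in>U. abs_gen (\<lambda>\<epsilon>. v \<epsilon> (rep_gen x \<epsilon>)))"
  have vmod: "moderate (\<lambda>\<epsilon>. mpderiv \<alpha> (v \<epsilon>) (\<xi> \<epsilon>))" if x: "x \<in> U" "represents \<xi> x" for x \<xi> \<alpha>
  proof -
    have m: "moderate \<xi>" using x by (simp add: represents_def)
    \<comment> \<open>Accuracy \<epsilon>^0 = 1 is enough here: a bounded net added to a moderate
      one is moderate.\<close>
    obtain k where k: "\<forall>\<^sub>F \<epsilon> in at_right 0.
        \<bar>mpderiv \<alpha> (v \<epsilon>) (\<xi> \<epsilon>) - mpderiv \<alpha> (u k \<epsilon>) (\<xi> \<epsilon>)\<bar> \<le> \<epsilon> ^ 0"
      using close[OF m m, of \<alpha> 0] by auto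
    have "moderate (\<lambda>\<epsilon>. mpderiv \<alpha> (v \<epsilon>) (\<xi> \<epsilon>) - mpderiv \<alpha> (u k \<epsilon>) (\<xi> \<epsilon>))"
      by (rule moderate_bound[OF moderate_const[of "1::real"]]) (use k in simp)
    from moderate_add[OF this defines_gsf_moderate_mpderiv[OF u x, of \<alpha> k]] show ?thesis by simp
  qed
  have g: "defines_gsf (\<lambda>_. UNIV) v U g"
    unfolding defines_gsf_def
  proof (intro conjI ballI allI impI)
    show "smooth_on UNIV (v \<epsilon>)" if "\<epsilon> \<in> {0<..1}" for \<epsilon> unfolding v_def by (rule smooth[OF that])
    show "U \<subseteq> strongly_internal_set (\<lambda>_. UNIV)" by (simp add: strongly_internal_set_def)
    fix x \<xi> assume x: "x \<in> U" "represents \<xi> x"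
    note r = represents_rep[of x]
    show "represents (\<lambda>\<epsilon>. v \<epsilon> (\<xi> \<epsilon>)) (g x)"
    proof (rule represents_cong)
      show "represents (\<lambda>\<epsilon>. v \<epsilon> (rep_gen x \<epsilon>)) (g x)"
        using x vmod[OF x(1) r, of "\<lambda>_. 0"] by (simp add: g_def mpderiv_zero represents_def)
      show "negligible_net (\<lambda>\<epsilon>. v \<epsilon> (\<xi> \<epsilon>) - v \<epsilon> (rep_gen x \<epsilon>))"
        unfolding negligible_net_iff
      proof
        fix m
        \<comment> \<open>Three differences arise, v against u k at both representatives and u k
          between them, each at most \<epsilon>^(m+1); hence \<epsilon> < 1/3 below.\<close>
        obtain k where k: "\<forall>\<^sub>F \<epsilon> in at_right 0. \<bar>v \<epsilon> (\<xi> \<epsilon>) - u k \<epsilon> (\<xi> \<epsilon>)\<bar> \<le> \<epsilon> ^ Suc m \<and>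
            \<bar>v \<epsilon> (rep_gen x \<epsilon>) - u k \<epsilon> (rep_gen x \<epsilon>)\<bar> \<le> \<epsilon> ^ Suc m"
          using close[of \<xi> "rep_gen x" "\<lambda>_. 0" "Suc m"] x(2) r
          unfolding represents_def mpderiv_zero by blast
        have "negligible_net (\<lambda>\<epsilon>. u k \<epsilon> (\<xi> \<epsilon>) - u k \<epsilon> (rep_gen x \<epsilon>))"
          by (rule represents_unique[OF defines_gsf_represents[OF u x] defines_gsf_represents[OF u x(1) r]])
        then have "\<forall>\<^sub>F \<epsilon> in at_right 0. \<bar>u k \<epsilon> (\<xi> \<epsilon>) - u k \<epsilon> (rep_gen x \<epsilon>)\<bar> \<le> \<epsilon> ^ Suc m"
          unfolding negligible_net_iff real_norm_def by blast
        then show "\<forall>\<^sub>F \<epsilon> in at_right 0. norm (v \<epsilon> (\<xi> \<epsilon>) - v \<epsilon> (rep_gen x \<epsilon>)) \<le> \<epsilon> ^ m"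
          using k eventually_small[of "1/3", simplified]
        proof eventually_elim
          case (elim \<epsilon>)
          have "(3 * \<epsilon>) * \<epsilon> ^ m \<le> 1 * \<epsilon> ^ m" using elim by (intro mult_right_mono) auto
          then have "3 * \<epsilon> ^ Suc m \<le> \<epsilon> ^ m" by simp
          then show ?case using elim unfolding real_norm_def by linarith
        qed
      qed
    qed
    show "moderate (\<lambda>\<epsilon>. mpderiv \<alpha> (v \<epsilon>) (\<xi> \<epsilon>))" for \<alpha> by (rule vmod[OF x])
  qed simp
  have "g \<in> GD K U"
    unfolding GD_def GSF_def represents_zero_iff
  proof (intro CollectI conjI exI[of _ v] exI[of _ "\<lambda>_. UNIV"] g ballI allI impI)
    show "g \<in> U \<rightarrow>\<^sub>E UNIV" by (simp add: g_def)
    fix x \<xi> \<alpha> assume x: "x \<in> gen_ext K" "represents \<xi> x"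
    show "negligible_net (\<lambda>\<epsilon>. mpderiv \<alpha> (v \<epsilon>) (\<xi> \<epsilon>))"
      unfolding negligible_net_iff
    proof
      fix m
      have m: "moderate \<xi>" using x by (simp add: represents_def)
      obtain k where k: "\<forall>\<^sub>F \<epsilon> in at_right 0.
          \<bar>mpderiv \<alpha> (v \<epsilon>) (\<xi> \<epsilon>) - mpderiv \<alpha> (u k \<epsilon>) (\<xi> \<epsilon>)\<bar> \<le> \<epsilon> ^ Suc m"
        using close[OF m m, of \<alpha> "Suc m"] by auto
      have "\<forall>\<^sub>F \<epsilon> in at_right 0. norm (mpderiv \<alpha> (u k \<epsilon>) (\<xi> \<epsilon>)) \<le> \<epsilon> ^ Suc m"
        using ext[OF x] unfolding negligible_net_iff by blast
      then show "\<forall>\<^sub>F \<epsilon> in at_right 0. norm (mpderiv \<alpha> (v \<epsilon>) (\<xi> \<epsilon>)) \<le> \<epsilon> ^ m"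
        using k eventually_small[of "1/2", simplified]
      proof eventually_elim
        case (elim \<epsilon>)
        have "(2 * \<epsilon>) * \<epsilon> ^ m \<le> 1 * \<epsilon> ^ m" using elim by (intro mult_right_mono) auto
        then have "2 * \<epsilon> ^ Suc m \<le> \<epsilon> ^ m" by simp
        then show ?case using elim unfolding real_norm_def by linarith
      qed
    qed
  qed
  moreover have "\<exists>i0. \<forall>i\<ge>i0. GD_dist K U m (f i) g <\<^sub>g \<rho>" if \<rho>: "0 <\<^sub>g \<rho>" for m \<rho>
  proof -
    have z: "represents (\<lambda>_. 0) (0::real gen)" by (simp add: represents_zero_iff negligible_net_zero)
    obtain q :: nat where q: "\<forall>\<^sub>F \<epsilon> in at_right 0. \<epsilon> ^ q \<le> rep_gen \<rho> \<epsilon> - 0"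
      using gless_iff[OF z represents_rep] \<rho> by blast
    obtain A N where A: "K = internal_set A"
      "\<forall>\<^sub>F \<epsilon> in at_right 0. A \<epsilon> \<noteq> {} \<and> (\<forall>x\<in>A \<epsilon>. norm x \<le> inverse \<epsilon> ^ N)"
      using functionally_compactE[OF K(1,2)] by blast
    \<comment> \<open>m covers the order and N the radius. Two errors \<epsilon>^k take at most 2
      \<epsilon>^(q+1) of the size \<epsilon>^q guaranteed for \<rho>, which for \<epsilon> < 1/3
      leaves \<epsilon>^(q+1).\<close>
    define k where "k = m + N + q + 2"
    \<comment> \<open>\<open>u i\<close> is linked to \<open>v\<close> through
      \<open>u (s k)\<close>, so the whole sequence converges and not only the subsequence.\<close>
    have "GD_dist K U m (f i) g <\<^sub>g \<rho>" if i: "n k \<le> i" for i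
    proof -
      note d = GD_dist_gless_iff[OF U u[of i] g K]
      have "gnorm (gsf_deriv U \<alpha> (\<lambda>x\<in>U. f i x - g x) x) <\<^sub>g \<rho>"
        if \<alpha>: "\<alpha> \<in> multi_indices_upto m" and "x \<in> K" for \<alpha> x
      proof -
        obtain \<xi> where \<xi>: "represents \<xi> x" "\<forall>\<^sub>F \<epsilon> in at_right 0. \<xi> \<epsilon> \<in> A \<epsilon>"
          using \<open>x \<in> K\<close> A(1) by (auto simp: internal_set_def)
        have r: "represents (\<lambda>\<epsilon>. norm (mpderiv \<alpha> (\<lambda>y. u i \<epsilon> y - v \<epsilon> y) (\<xi> \<epsilon>)))
            (gnorm (gsf_deriv U \<alpha> (\<lambda>x\<in>U. f i x - g x) x))"
          using K(3) \<open>x \<in> K\<close> by (intro represents_gnorm represents_gsf_deriv[OF U d(2) _ \<xi>(1)]) auto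
        have \<alpha>k: "\<alpha> \<in> multi_indices_upto k"
          by (rule multi_indices_upto_mono[OF _ \<alpha>]) (simp add: k_def)
        have "\<forall>\<^sub>F \<epsilon> in at_right 0.
            \<epsilon> ^ Suc q \<le> rep_gen \<rho> \<epsilon> - norm (mpderiv \<alpha> (\<lambda>y. u i \<epsilon> y - v \<epsilon> y) (\<xi> \<epsilon>))"
          using q A(2) \<xi>(2) key[of k] est[OF i s[OF order_refl], of k]
            eventually_small[of "1/3", simplified]
        proof eventually_elim
          case (elim \<epsilon>)
          have \<epsilon>: "\<epsilon> \<in> {0<..1}" using elim by auto
          have "inverse \<epsilon> ^ N \<le> inverse \<epsilon> ^ k"
            using elim by (intro power_increasing) (auto simp: k_def one_le_inverse_iff)
          then have "norm (\<xi> \<epsilon>) \<le> inverse \<epsilon> ^ k" using elim by (meson order_trans)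
          then have "\<bar>mpderiv \<alpha> (v \<epsilon>) (\<xi> \<epsilon>) - mpderiv \<alpha> (u (s k) \<epsilon>) (\<xi> \<epsilon>)\<bar> \<le> \<epsilon> ^ k"
            "\<bar>mpderiv \<alpha> (u i \<epsilon>) (\<xi> \<epsilon>) - mpderiv \<alpha> (u (s k) \<epsilon>) (\<xi> \<epsilon>)\<bar> \<le> \<epsilon> ^ k"
            using elim \<alpha>k by blast+
          moreover have "\<epsilon> ^ k \<le> \<epsilon> ^ Suc q"
            using elim by (intro power_decreasing) (auto simp: k_def)
          moreover have "(3 * \<epsilon>) * \<epsilon> ^ q \<le> 1 * \<epsilon> ^ q" using elim by (intro mult_right_mono) auto
          then have "3 * \<epsilon> ^ Suc q \<le> \<epsilon> ^ q" by simp
          \<comment> \<open>At a fixed \<epsilon> the function \<open>v \<epsilon>\<close> is one of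
            the \<open>u j \<epsilon>\<close>, so \<open>mdiff\<close> applies to it.\<close>
          ultimately show ?case
            using elim(1) unfolding v_def mdiff[OF \<epsilon>] real_norm_def by linarith
        qed
        then show ?thesis using gless_iff[OF r represents_rep] by blast
      qed
      then show ?thesis using d(1) by blast
    qed
    then show ?thesis by blast
  qed
  then have "\<forall>\<^sub>F i in sequentially. f i \<in> V" if V: "GD_open K U V" "g \<in> V" for V
  proof -
    obtain m \<rho> where "0 <\<^sub>g \<rho>" "{h \<in> GD K U. GD_dist K U m h g <\<^sub>g \<rho>} \<subseteq> V"
      using V unfolding GD_open_def by blast
    moreover have "f i \<in> GD K U" for i using cauchy unfolding GD_Cauchy_def by blast
    ultimately show ?thesis
      using \<open>\<And>m \<rho>. 0 <\<^sub>g \<rho> \<Longrightarrow> \<exists>i0. \<forall>i\<ge>i0. GD_dist K U m (f i) g <\<^sub>g \<rho>\<close>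
      unfolding eventually_sequentially by blast
  qed
  ultimately show "\<exists>g. limitin (GD_topology K U) f g sequentially"
    unfolding limitin_def topspace_GD_topology openin_GD_topology by blast
qed

end
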